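(* Let $M=(m_{ij})_{i,j\in I}$ and $M'=(m'_{ij})_{i,j\in I'}$ be Coxeter matrices over finite sets $I$, $I'$, and let $(W(M),\star)=\langle s_i:i\in I\rangle$ and $(W(M'),\star)=\langle s'_i:i\in I'\rangle$ be the respective Hecke monoids. (a) Given a family $\boldsymbol K=\{K_i: i\in I'\}$ of subsets of $I$ such that each $W_{K_i}(M)$ is finite, the assignments $s'_i\mapsto w_\circ^{K_i}$, $i\in I'$, define a homomorphism of monoids $\phi_{\boldsymbol K}:(W(M'),\star)\to(W(M),\star)$ if and only if for all $i\neq j\in I'$ either $m'_{ij}=\infty$, or $W_{K_i\cup K_j}(M)$ is finite and $$m'_{ij}\ge\max(\mu_M(K_i,K_j),\mu_M(K_j,K_i)).$$ (b) All homomorphisms of Hecke monoids $(W(M'),\star)\to(W(M),\star)$ are of this form.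
   Context: A Coxeter matrix over a finite set $I$ is a symmetric matrix $M=(m_{ij})_{i,j\in I}$ with $m_{ii}=1$ and $m_{ij}\in\mathbb Z_{\ge 2}\cup\{\infty\}$ for $i\ne j$. $W(M)$ is the corresponding Coxeter group with simple generators $s_i$ and length function $\ell$. The Hecke monoid $(W(M),\star)$ is the monoid generated by $s_i$, $i\in I$, subject to $s_i\star s_i=s_i$ and $s_i\star s_j\star s_i\star\cdots=s_j\star s_i\star s_j\star\cdots$ ($m_{ij}$ factors on each side) for $i\neq j$ with $m_{ij}<\infty$; as a set it is identified with $W(M)$, the product being determined by $s_i\star w=s_iw$ if $\ell(s_iw)>\ell(w)$ and $s_i\star w=w$ otherwise. Homomorphisms of monoids map the identity to the identity. For $K\subset I$, $W_K(M)=\langle s_k:k\in K\rangle$; if it is finite, $w_\circ^K$ is its longest element ($w_\circ^\emptyset=1$). If $J,K\subset I$ and $W_{J\cup K}(M)$ is finite, $\mu_M(J,K)$ denotes the minimal positive integer $m$ such that the alternating product $w_\circ^J\star w_\circ^K\star w_\circ^J\star\cdots$ with $m$ factors, starting with $w_\circ^J$, equals $w_\circ^{J\cup K}$ (such an $m$ always exists). *)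

theory Defs
  imports "HOL-Algebra.Generated_Groups" "HOL-Library.Extended_Nat"
begin

section \<open>Monoids given by generators and relations\<close>

inductive pres_cong :: "('a list \<times> 'a list) set \<Rightarrow> 'a list \<Rightarrow> 'a list \<Rightarrow> bool"
  for R :: "('a list \<times> 'a list) set" where
  rel: "(u, v) \<in> R \<Longrightarrow> pres_cong R (x @ u @ y) (x @ v @ y)"
| refl: "pres_cong R u u"
| sym: "pres_cong R u v \<Longrightarrow> pres_cong R v u"
| trans: "pres_cong R u v \<Longrightarrow> pres_cong R v w \<Longrightarrow> pres_cong R u w"

definition pres_rel :: "'a set \<Rightarrow> ('a list \<times> 'a list) set \<Rightarrow> ('a list \<times> 'a list) set" where
  "pres_rel S R = {(u, v). u \<in> lists S \<and> v \<in> lists S \<and> pres_cong R u v}"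

definition pres_class :: "'a set \<Rightarrow> ('a list \<times> 'a list) set \<Rightarrow> 'a list \<Rightarrow> 'a list set" where
  "pres_class S R u = pres_rel S R `` {u}"

definition pres_monoid :: "'a set \<Rightarrow> ('a list \<times> 'a list) set \<Rightarrow> 'a list set monoid" where
  "pres_monoid S R =
    \<lparr>carrier = lists S // pres_rel S R,
     mult = (\<lambda>A B. \<Union>a\<in>A. \<Union>b\<in>B. pres_class S R (a @ b)),
     one = pres_class S R []\<rparr>"

lemma pres_cong_append:
  assumes "pres_cong R u u'" and "pres_cong R v v'"
  shows "pres_cong R (u @ v) (u' @ v')"
proof -
  have left: "pres_cong R (x @ p) (x @ q)" if "pres_cong R p q" for x p q
    using that
  proof induction
    case (rel a b y z)
    then show ?case using pres_cong.rel[of a b R "x @ y" z] by simp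
  qed (rule pres_cong.refl, erule pres_cong.sym, erule (1) pres_cong.trans)
  have right: "pres_cong R (p @ x) (q @ x)" if "pres_cong R p q" for x p q
    using that
  proof induction
    case (rel a b y z)
    then show ?case using pres_cong.rel[of a b R y "z @ x"] by simp
  qed (rule pres_cong.refl, erule pres_cong.sym, erule (1) pres_cong.trans)
  show ?thesis
    by (rule pres_cong.trans[OF right[OF assms(1)] left[OF assms(2)]])
qed

lemma equiv_pres_rel: "equiv (lists S) (pres_rel S R)"
proof (rule equivI)
  show "pres_rel S R \<subseteq> lists S \<times> lists S"
    by (auto simp: pres_rel_def)
  show "refl_on (lists S) (pres_rel S R)"
    by (auto simp: pres_rel_def refl_on_def intro: pres_cong.refl)
  show "sym (pres_rel S R)"
    unfolding sym_def pres_rel_def using pres_cong.sym[of R] by blast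
  show "trans (pres_rel S R)"
    unfolding trans_def pres_rel_def using pres_cong.trans[of R] by blast
qed

lemma pres_class_eq_iff:
  assumes "u \<in> lists S" and "v \<in> lists S"
  shows "pres_class S R u = pres_class S R v \<longleftrightarrow> pres_cong R u v"
  unfolding pres_class_def
  using assms eq_equiv_class_iff[OF equiv_pres_rel assms] by (simp add: pres_rel_def)

lemma carrier_pres_monoid: "carrier (pres_monoid S R) = pres_class S R ` lists S"
  by (auto simp: pres_monoid_def quotient_def pres_class_def)

lemma one_pres_monoid: "\<one>\<^bsub>pres_monoid S R\<^esub> = pres_class S R []"
  by (simp add: pres_monoid_def)

lemma mult_pres_class:
  assumes "u \<in> lists S" and "v \<in> lists S"
  shows "pres_class S R u \<otimes>\<^bsub>pres_monoid S R\<^esub> pres_class S R v = pres_class S R (u @ v)"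
proof -
  have mem: "a \<in> lists S \<and> pres_cong R p a" if "a \<in> pres_class S R p" for a p
    using that by (auto simp: pres_class_def pres_rel_def)
  have self: "p \<in> pres_class S R p" if "p \<in> lists S" for p
    using that by (auto simp: pres_class_def pres_rel_def intro: pres_cong.refl)
  have eq: "pres_class S R (a @ b) = pres_class S R (u @ v)"
    if "a \<in> pres_class S R u" "b \<in> pres_class S R v" for a b
  proof -
    have "pres_cong R (a @ b) (u @ v)"
      by (rule pres_cong.sym, rule pres_cong_append)
        (use mem[OF that(1)] mem[OF that(2)] in blast)+
    then show ?thesis
      using mem[OF that(1)] mem[OF that(2)] assms by (subst pres_class_eq_iff) auto
  qed
  have "(\<Union>a\<in>pres_class S R u. \<Union>b\<in>pres_class S R v. pres_class S R (a @ b)) =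
      pres_class S R (u @ v)"
    using eq self[OF assms(1)] self[OF assms(2)] by blast
  then show ?thesis
    by (simp add: pres_monoid_def)
qed

lemma monoid_pres_monoid: "monoid (pres_monoid S R)"
proof (rule monoidI)
  fix x y z
  assume "x \<in> carrier (pres_monoid S R)" "y \<in> carrier (pres_monoid S R)"
    "z \<in> carrier (pres_monoid S R)"
  then obtain u v w where w: "u \<in> lists S" "v \<in> lists S" "w \<in> lists S"
    and eq: "x = pres_class S R u" "y = pres_class S R v" "z = pres_class S R w"
    unfolding carrier_pres_monoid by blast
  have app: "u @ v \<in> lists S" "v @ w \<in> lists S"
    using w by auto
  show "x \<otimes>\<^bsub>pres_monoid S R\<^esub> y \<in> carrier (pres_monoid S R)"
    unfolding eq mult_pres_class[OF w(1,2)] carrier_pres_monoid using app by blast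
  show "\<one>\<^bsub>pres_monoid S R\<^esub> \<otimes>\<^bsub>pres_monoid S R\<^esub> x = x"
    using mult_pres_class[OF lists.Nil w(1)] by (simp add: one_pres_monoid eq)
  show "x \<otimes>\<^bsub>pres_monoid S R\<^esub> \<one>\<^bsub>pres_monoid S R\<^esub> = x"
    using mult_pres_class[OF w(1) lists.Nil] by (simp add: one_pres_monoid eq)
  show "x \<otimes>\<^bsub>pres_monoid S R\<^esub> y \<otimes>\<^bsub>pres_monoid S R\<^esub> z =
      x \<otimes>\<^bsub>pres_monoid S R\<^esub> (y \<otimes>\<^bsub>pres_monoid S R\<^esub> z)"
    unfolding eq mult_pres_class[OF w(1,2)] mult_pres_class[OF w(2,3)]
      mult_pres_class[OF app(1) w(3)] mult_pres_class[OF w(1) app(2)] by simp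
next
  show "\<one>\<^bsub>pres_monoid S R\<^esub> \<in> carrier (pres_monoid S R)"
    unfolding carrier_pres_monoid one_pres_monoid by blast
qed


section \<open>Coxeter groups\<close>

definition coxeter_matrix :: "'a set \<Rightarrow> ('a \<Rightarrow> 'a \<Rightarrow> enat) \<Rightarrow> bool" where
  "coxeter_matrix I M \<longleftrightarrow> finite I \<and>
    (\<forall>i\<in>I. \<forall>j\<in>I. M i j = M j i) \<and>
    (\<forall>i\<in>I. M i i = 1) \<and>
    (\<forall>i\<in>I. \<forall>j\<in>I. i \<noteq> j \<longrightarrow> 2 \<le> M i j)"

text \<open>
  The relations \<open>(s\<^sub>i s\<^sub>j)\<^sup>m = 1\<close> for \<open>m = M i j < \<infinity>\<close>. The case \<open>i = j\<close> gives \<open>s\<^sub>i\<^sup>2 = 1\<close>, so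
  every generator is invertible in the presented monoid, which is therefore the group
  with the same presentation.
\<close>

definition coxeter_rels :: "'a set \<Rightarrow> ('a \<Rightarrow> 'a \<Rightarrow> enat) \<Rightarrow> ('a list \<times> 'a list) set" where
  "coxeter_rels I M =
    {(concat (replicate m [i, j]), []) | i j m. i \<in> I \<and> j \<in> I \<and> M i j = enat m}"

definition coxeter_group :: "'a set \<Rightarrow> ('a \<Rightarrow> 'a \<Rightarrow> enat) \<Rightarrow> 'a list set monoid" where
  "coxeter_group I M = pres_monoid I (coxeter_rels I M)"

definition coxeter_elt :: "'a set \<Rightarrow> ('a \<Rightarrow> 'a \<Rightarrow> enat) \<Rightarrow> 'a list \<Rightarrow> 'a list set" where
  "coxeter_elt I M u = pres_class I (coxeter_rels I M) u"

lemma group_coxeter_group: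
  assumes "coxeter_matrix I M"
  shows "group (coxeter_group I M)"
proof -
  interpret monoid "coxeter_group I M"
    unfolding coxeter_group_def by (rule monoid_pres_monoid)
  have sq: "pres_cong (coxeter_rels I M) [i, i] []" if "i \<in> I" for i
  proof -
    have "M i i = enat 1"
      using that assms by (simp add: coxeter_matrix_def one_enat_def)
    then have "(concat (replicate 1 [i, i]), []) \<in> coxeter_rels I M"
      using that unfolding coxeter_rels_def by blast
    then show ?thesis
      using pres_cong.rel[of "[i, i]" "[]" "coxeter_rels I M" "[]" "[]"] by simp
  qed
  have inv: "pres_cong (coxeter_rels I M) (rev u @ u) []" if "u \<in> lists I" for u
    using that
  proof (induction u)
    case Nil
    then show ?case by (simp add: pres_cong.refl)
  next
    case (Cons i u)
    have "pres_cong (coxeter_rels I M) (rev u @ [i, i] @ u) (rev u @ [] @ u)"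
      using Cons sq by (intro pres_cong_append pres_cong.refl) auto
    moreover have "pres_cong (coxeter_rels I M) (rev u @ u) []"
      using Cons by simp
    ultimately have "pres_cong (coxeter_rels I M) (rev u @ [i, i] @ u) []"
      by (metis append_Nil pres_cong.trans)
    then show ?case by simp
  qed
  show ?thesis
  proof (rule group_l_invI)
    fix x assume "x \<in> carrier (coxeter_group I M)"
    then obtain u where u: "u \<in> lists I" "x = pres_class I (coxeter_rels I M) u"
      by (auto simp: coxeter_group_def carrier_pres_monoid simp del: in_lists_conv_set)
    have r: "rev u \<in> lists I" using u(1) by auto
    have "pres_class I (coxeter_rels I M) (rev u) \<otimes>\<^bsub>coxeter_group I M\<^esub> x = \<one>\<^bsub>coxeter_group I M\<^esub>"
      unfolding coxeter_group_def u(2) mult_pres_class[OF r u(1)] one_pres_monoid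
      using inv[OF u(1)] u(1) r by (subst pres_class_eq_iff) auto
    moreover have "pres_class I (coxeter_rels I M) (rev u) \<in> carrier (coxeter_group I M)"
      using r by (auto simp: coxeter_group_def carrier_pres_monoid)
    ultimately show "\<exists>y\<in>carrier (coxeter_group I M).
        y \<otimes>\<^bsub>coxeter_group I M\<^esub> x = \<one>\<^bsub>coxeter_group I M\<^esub>" by blast
  qed
qed

definition coxeter_length :: "'a set \<Rightarrow> ('a \<Rightarrow> 'a \<Rightarrow> enat) \<Rightarrow> 'a list set \<Rightarrow> nat" where
  "coxeter_length I M w = (LEAST n. \<exists>u\<in>lists I. coxeter_elt I M u = w \<and> length u = n)"

definition parabolic :: "'a set \<Rightarrow> ('a \<Rightarrow> 'a \<Rightarrow> enat) \<Rightarrow> 'a set \<Rightarrow> 'a list set set" where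
  "parabolic I M K = generate (coxeter_group I M) ((\<lambda>k. coxeter_elt I M [k]) ` K)"

text \<open>Meaningful only if \<open>parabolic I M K\<close> is finite.\<close>

definition longest_elt :: "'a set \<Rightarrow> ('a \<Rightarrow> 'a \<Rightarrow> enat) \<Rightarrow> 'a set \<Rightarrow> 'a list set" where
  "longest_elt I M K = (THE w. w \<in> parabolic I M K \<and>
     (\<forall>v\<in>parabolic I M K. coxeter_length I M v \<le> coxeter_length I M w))"


section \<open>Hecke monoids\<close>

fun alt_word :: "nat \<Rightarrow> 'a \<Rightarrow> 'a \<Rightarrow> 'a list" where
  "alt_word 0 a b = []"
| "alt_word (Suc m) a b = a # alt_word m b a"

definition hecke_rels :: "'a set \<Rightarrow> ('a \<Rightarrow> 'a \<Rightarrow> enat) \<Rightarrow> ('a list \<times> 'a list) set" where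
  "hecke_rels I M = {([i, i], [i]) | i. i \<in> I} \<union>
    {(alt_word m i j, alt_word m j i) | i j m. i \<in> I \<and> j \<in> I \<and> i \<noteq> j \<and> M i j = enat m}"

definition hecke_monoid :: "'a set \<Rightarrow> ('a \<Rightarrow> 'a \<Rightarrow> enat) \<Rightarrow> 'a list set monoid" where
  "hecke_monoid I M = pres_monoid I (hecke_rels I M)"

definition hecke_elt :: "'a set \<Rightarrow> ('a \<Rightarrow> 'a \<Rightarrow> enat) \<Rightarrow> 'a list \<Rightarrow> 'a list set" where
  "hecke_elt I M u = pres_class I (hecke_rels I M) u"

definition hecke_gen :: "'a set \<Rightarrow> ('a \<Rightarrow> 'a \<Rightarrow> enat) \<Rightarrow> 'a \<Rightarrow> 'a list set" where
  "hecke_gen I M i = hecke_elt I M [i]"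

definition reduced_word :: "'a set \<Rightarrow> ('a \<Rightarrow> 'a \<Rightarrow> enat) \<Rightarrow> 'a list set \<Rightarrow> 'a list \<Rightarrow> bool" where
  "reduced_word I M w u \<longleftrightarrow>
    u \<in> lists I \<and> coxeter_elt I M u = w \<and> length u = coxeter_length I M w"

text \<open>
  The identification of the Coxeter group with the underlying set of the Hecke monoid:
  \<open>w = s\<^sub>i \<cdots> s\<^sub>j\<close> (reduced) corresponds to \<open>s\<^sub>i \<star> \<cdots> \<star> s\<^sub>j\<close>. The choice of the reduced word is
  irrelevant by Matsumoto's theorem. This is the identification under which \<open>s\<^sub>i \<star> w\<close> is
  \<open>s\<^sub>i w\<close> or \<open>w\<close>, according to whether \<open>s\<^sub>i w\<close> is longer than \<open>w\<close> or not.
\<close>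

definition to_hecke :: "'a set \<Rightarrow> ('a \<Rightarrow> 'a \<Rightarrow> enat) \<Rightarrow> 'a list set \<Rightarrow> 'a list set" where
  "to_hecke I M w = hecke_elt I M (SOME u. reduced_word I M w u)"

definition hecke_longest :: "'a set \<Rightarrow> ('a \<Rightarrow> 'a \<Rightarrow> enat) \<Rightarrow> 'a set \<Rightarrow> 'a list set" where
  "hecke_longest I M K = to_hecke I M (longest_elt I M K)"

fun alt_prod :: "('c, 'd) monoid_scheme \<Rightarrow> nat \<Rightarrow> 'c \<Rightarrow> 'c \<Rightarrow> 'c" where
  "alt_prod G 0 x y = \<one>\<^bsub>G\<^esub>"
| "alt_prod G (Suc m) x y = x \<otimes>\<^bsub>G\<^esub> alt_prod G m y x"

text \<open>Meaningful only if \<open>parabolic I M (J \<union> K)\<close> is finite.\<close>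

definition hecke_mu :: "'a set \<Rightarrow> ('a \<Rightarrow> 'a \<Rightarrow> enat) \<Rightarrow> 'a set \<Rightarrow> 'a set \<Rightarrow> nat" where
  "hecke_mu I M J K = (LEAST m. 0 < m \<and>
     alt_prod (hecke_monoid I M) m (hecke_longest I M J) (hecke_longest I M K)
       = hecke_longest I M (J \<union> K))"

text \<open>The library's \<^const>\<open>hom\<close> does not require the identity to be preserved.\<close>

definition monoid_hom :: "('c, 'e) monoid_scheme \<Rightarrow> ('d, 'f) monoid_scheme \<Rightarrow> ('c \<Rightarrow> 'd) set" where
  "monoid_hom G H = {\<phi> \<in> hom G H. \<phi> \<one>\<^bsub>G\<^esub> = \<one>\<^bsub>H\<^esub>}"

definition admissible_family ::
  "'b set \<Rightarrow> 'a set \<Rightarrow> ('a \<Rightarrow> 'a \<Rightarrow> enat) \<Rightarrow> ('b \<Rightarrow> 'a set) \<Rightarrow> bool" where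
  "admissible_family I' I M K \<longleftrightarrow> (\<forall>i\<in>I'. K i \<subseteq> I \<and> finite (parabolic I M (K i)))"

text \<open>
  \<open>\<phi>\<close> is the homomorphism determined by \<open>s'\<^sub>i \<mapsto> w\<^sub>\<circ>(K\<^sub>i)\<close>; it is unique on the carrier because
  the \<open>s'\<^sub>i\<close> generate.
\<close>

definition is_phi ::
  "'b set \<Rightarrow> ('b \<Rightarrow> 'b \<Rightarrow> enat) \<Rightarrow> 'a set \<Rightarrow> ('a \<Rightarrow> 'a \<Rightarrow> enat) \<Rightarrow> ('b \<Rightarrow> 'a set)
    \<Rightarrow> ('b list set \<Rightarrow> 'a list set) \<Rightarrow> bool" where
  "is_phi I' M' I M K \<phi> \<longleftrightarrow> \<phi> \<in> monoid_hom (hecke_monoid I' M') (hecke_monoid I M) \<and>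
    (\<forall>i\<in>I'. \<phi> (hecke_gen I' M' i) = hecke_longest I M (K i))"

end

theory Submission
  imports Defs Complex_Main "HOL-Library.Sublist"
begin

text \<open>
  Sending a word to the set of elements of the Coxeter group represented by its subwords respects
  the Hecke relations, since for both sides of a braid relation one obtains the whole dihedral
  subgroup. A reduced word is recovered, up to the Coxeter relations, as the longest element of
  this set; with Matsumoto's theorem the invariant is therefore faithful on the Hecke monoid. As it
  is monotone under multiplication, \<open>a \<star> b \<star> x = x\<close> implies \<open>b \<star> x = x\<close>.

  Hence an idempotent \<open>x\<close> absorbs every generator occurring in it. Such an \<open>x\<close> is determined by
  its support \<open>K\<close>, all of \<open>W\<^sub>K\<close> occurs among its subwords, and so \<open>W\<^sub>K\<close> is finite and \<open>x\<close> is its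
  longest element. Finally, if the two alternating products with \<open>m \<ge> 2\<close> factors \<open>x, y\<close> agree,
  their common value absorbs the generators of \<open>x\<close> and of \<open>y\<close>, so it is the longest element for the
  union of the supports; conversely, an alternating product stays there once it has reached it.
\<close>

section \<open>Congruences and alternating words\<close>

lemma pres_cong_left: "pres_cong R u v \<Longrightarrow> pres_cong R (x @ u) (x @ v)"
  by (intro pres_cong_append pres_cong.refl)

lemma pres_cong_right: "pres_cong R u v \<Longrightarrow> pres_cong R (u @ x) (v @ x)"
  by (intro pres_cong_append pres_cong.refl)

lemma pres_cong_Cons: "pres_cong R u v \<Longrightarrow> pres_cong R (i # u) (i # v)"
  using pres_cong_left[of R u v "[i]"] by simp

lemma pres_cong_base: "(u, v) \<in> R \<Longrightarrow> pres_cong R u v"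
  using pres_cong.rel[of u v R "[]" "[]"] by simp

lemma pres_cong_map:
  assumes "pres_cong R u v"
    and "\<And>u v. (u, v) \<in> R \<Longrightarrow> pres_cong R' (f u) (f v)"
    and "\<And>u v. f (u @ v) = f u @ f v"
  shows "pres_cong R' (f u) (f v)"
  using assms(1)
proof induction
  case (rel u v x y)
  then show ?case
    by (simp add: assms pres_cong_append pres_cong.refl)
qed (blast intro: pres_cong.intros)+

lemma pres_cong_rev:
  assumes "pres_cong R u v"
    and "\<And>u v. (u, v) \<in> R \<Longrightarrow> pres_cong R (rev u) (rev v)"
  shows "pres_cong R (rev u) (rev v)"
  using assms(1)
proof induction
  case (rel u v x y)
  then show ?case
    by (simp add: assms pres_cong_append pres_cong.refl)
qed (blast intro: pres_cong.intros)+

lemma length_alt_word [simp]: "length (alt_word n a b) = n"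
  by (induction n arbitrary: a b) auto

lemma alt_word_add:
  "alt_word (m + n) a b = alt_word m a b @ (if even m then alt_word n a b else alt_word n b a)"
  by (induction m arbitrary: a b) auto

lemma alt_word_snoc: "alt_word (Suc n) a b = alt_word n a b @ [if even n then a else b]"
  using alt_word_add[of n 1 a b] by simp

lemma rev_alt_word: "rev (alt_word n a b) = (if odd n then alt_word n a b else alt_word n b a)"
proof (induction n arbitrary: a b)
  case (Suc n)
  then show ?case
    using alt_word_snoc[of n a b] alt_word_snoc[of n b a] by auto
qed simp

text \<open>The relator with \<open>2 * n\<close> letters splits into one side of a braid relation
  and the reversal of the other side. Reversal is inversion in a Coxeter group, so the relator is
  trivial exactly when the two sides agree; \<open>cox_alt_word_swap\<close> draws this
  conclusion.\<close>

lemma alt_word_double: "alt_word (2 * n) a b = alt_word n a b @ rev (alt_word n b a)"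
  using alt_word_add[of n n a b] by (simp add: rev_alt_word mult_2)

lemma concat_replicate_pair: "concat (replicate n [a, b]) = alt_word (2 * n) a b"
  by (induction n) auto

lemma set_alt_word: "set (alt_word n a b) \<subseteq> {a, b}"
  by (induction n arbitrary: a b) auto

lemma set_alt_word_eq:
  assumes "2 \<le> n"
  shows "set (alt_word n a b) = {a, b}"
proof -
  obtain k where "n = Suc (Suc k)" using assms by (metis add_2_eq_Suc le_Suc_ex)
  then show ?thesis using set_alt_word[of k a b] by auto
qed

lemma map_alt_word: "map f (alt_word n a b) = alt_word n (f a) (f b)"
  by (induction n arbitrary: a b) auto

lemma foldr_alt_word:
  "foldr f (alt_word (2 * n) a b) = ((f a \<circ> f b) ^^ n)"
  by (induction n) (simp_all add: fun_eq_iff)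

lemma sin_pi_div_pos:
  assumes "2 \<le> m"
  shows "0 < sin (pi / real m)"
proof (rule sin_gt_zero)
  have "pi / real m \<le> pi / 2" using assms by (intro divide_left_mono) auto
  then show "pi / real m < pi" using pi_gt_zero by linarith
qed (use assms in simp)

section \<open>Word calculus modulo the Coxeter and the Hecke relations\<close>

locale coxeter =
  fixes I :: "'a set" and M :: "'a \<Rightarrow> 'a \<Rightarrow> enat"
  assumes matrix: "coxeter_matrix I M"
begin

abbreviation cox_eq (infix "\<approx>" 50) where
  "u \<approx> v \<equiv> pres_cong (coxeter_rels I M) u v"

abbreviation hecke_eq (infix "\<simeq>" 50) where
  "u \<simeq> v \<equiv> pres_cong (hecke_rels I M) u v"

lemma M_sym: "i \<in> I \<Longrightarrow> j \<in> I \<Longrightarrow> M i j = M j i"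
  using matrix by (simp add: coxeter_matrix_def)

lemma M_diag: "i \<in> I \<Longrightarrow> M i i = 1"
  using matrix by (simp add: coxeter_matrix_def)

lemma M_ge_2: "i \<in> I \<Longrightarrow> j \<in> I \<Longrightarrow> i \<noteq> j \<Longrightarrow> 2 \<le> M i j"
  using matrix by (simp add: coxeter_matrix_def)

lemma cox_relE:
  assumes "(u, v) \<in> coxeter_rels I M"
  obtains i j m where "i \<in> I" "j \<in> I" "M i j = enat m" "u = alt_word (2 * m) i j" "v = []"
  using assms by (auto simp: coxeter_rels_def concat_replicate_pair)

lemma cox_rel: "i \<in> I \<Longrightarrow> j \<in> I \<Longrightarrow> M i j = enat m \<Longrightarrow> alt_word (2 * m) i j \<approx> []"
  by (rule pres_cong_base) (auto simp: coxeter_rels_def concat_replicate_pair)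

lemma cox_square:
  assumes "i \<in> I"
  shows "[i, i] \<approx> []"
  using cox_rel[OF assms assms, of 1] M_diag[OF assms] by (simp add: one_enat_def numeral_2_eq_2)

lemma cox_Cons_Cons:
  assumes "i \<in> I"
  shows "i # i # u \<approx> u"
  using pres_cong_right[OF cox_square[OF assms], of u] by simp

lemma cox_rev:
  assumes "u \<approx> v"
  shows "rev u \<approx> rev v"
proof (rule pres_cong_rev[OF assms])
  fix u v assume "(u, v) \<in> coxeter_rels I M"
  then show "rev u \<approx> rev v"
    by (rule cox_relE) (auto simp: rev_alt_word M_sym intro!: cox_rel)
qed

text \<open>\<open>pres_cong\<close> relates words over the whole type. Relators only involve
  letters of \<open>I\<close>, so a congruence class that meets the words over \<open>I\<close>
  stays among them.\<close>

lemma cox_set: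
  assumes "u \<approx> v"
  shows "set u \<subseteq> I \<longleftrightarrow> set v \<subseteq> I"
  using assms
proof induction
  case (rel u v x y)
  then obtain i j m where "i \<in> I" "j \<in> I" "u = alt_word (2 * m) i j" "v = []"
    by (metis cox_relE)
  then show ?case using set_alt_word[of "2 * m" i j] by auto
qed auto

lemma cox_append_rev: "set u \<subseteq> I \<Longrightarrow> u @ rev u \<approx> []"
proof (induction u)
  case (Cons i u)
  then have "u @ rev u \<approx> []" by simp
  from pres_cong_append[OF pres_cong.refl[of _ "[i]"] pres_cong_right[OF this, of "[i]"]]
  have "(i # u) @ rev (i # u) \<approx> [i, i]" by simp
  then show ?case using cox_square Cons.prems by (auto intro: pres_cong.trans)
qed (simp add: pres_cong.refl)

lemma cox_rev_append: "set u \<subseteq> I \<Longrightarrow> rev u @ u \<approx> []"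
  using cox_append_rev[of "rev u"] by simp

lemma cox_cancel_left:
  assumes "set x \<subseteq> I" and "x @ u \<approx> x @ v"
  shows "u \<approx> v"
proof -
  have *: "rev x @ x @ w \<approx> w" for w
    using pres_cong_right[OF cox_rev_append[OF assms(1)], of w] by simp
  show ?thesis
    using pres_cong.trans[OF pres_cong.trans[OF pres_cong.sym[OF *]
      pres_cong_left[OF assms(2), of "rev x"]] *] .
qed

lemma cox_cancel_right:
  assumes "set x \<subseteq> I" and "u @ x \<approx> v @ x"
  shows "u \<approx> v"
  using cox_rev[OF cox_cancel_left[of "rev x" "rev u" "rev v"]] cox_rev[OF assms(2)] assms(1)
  by simp

lemma cox_cancel_Cons: "i \<in> I \<Longrightarrow> i # u \<approx> i # v \<Longrightarrow> u \<approx> v"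
  using cox_cancel_left[of "[i]" u v] by simp

lemma cox_append_rev_iff:
  assumes "set v \<subseteq> I"
  shows "u @ rev v \<approx> [] \<longleftrightarrow> u \<approx> v"
proof
  assume "u @ rev v \<approx> []"
  then have "u @ rev v \<approx> v @ rev v"
    using cox_append_rev[OF assms] by (blast intro: pres_cong.intros)
  then show "u \<approx> v" using cox_cancel_right assms by (metis set_rev)
next
  assume "u \<approx> v"
  then show "u @ rev v \<approx> []"
    using cox_append_rev[OF assms] by (blast intro: pres_cong.trans pres_cong_right)
qed

lemma cox_alt_word_swap:
  assumes "i \<in> I" and "j \<in> I"
  shows "alt_word (2 * n) i j \<approx> [] \<longleftrightarrow> alt_word n i j \<approx> alt_word n j i"
  unfolding alt_word_double
  by (rule cox_append_rev_iff) (use set_alt_word[of n j i] assms in auto)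

section \<open>The exchange condition\<close>

text \<open>
  Reading \<open>t\<close> as a reflection, \<open>parity u t\<close> says that \<open>t\<close> occurs an odd number of times among the
  reflections \<open>s\<^sub>1 \<cdots> s\<^sub>k\<^sub>-\<^sub>1 s\<^sub>k s\<^sub>k\<^sub>-\<^sub>1 \<cdots> s\<^sub>1\<close> attached to the prefixes of \<open>u\<close>, up to \<open>\<approx>\<close>.
\<close>

primrec parity :: "'a list \<Rightarrow> 'a list \<Rightarrow> bool" where
  "parity [] t = False"
| "parity (i # u) t = (([i] \<approx> t) \<noteq> parity u (i # t @ [i]))"

lemma parity_cong:
  assumes "t \<approx> t'"
  shows "parity u t = parity u t'"
  using assms
proof (induction u arbitrary: t t')
  case (Cons i u)
  have "i # t @ [i] \<approx> i # t' @ [i]"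
    using Cons.prems by (intro pres_cong_Cons pres_cong_right)
  moreover have "[i] \<approx> t \<longleftrightarrow> [i] \<approx> t'"
    using Cons.prems by (blast intro: pres_cong.intros)
  ultimately show ?case using Cons.IH by simp
qed simp

lemma parity_append: "parity (x @ y) t = (parity x t \<noteq> parity y (rev x @ t @ x))"
  by (induction x arbitrary: t) auto

lemma cox_conj_iff:
  assumes "i \<in> I"
  shows "u \<approx> i # t @ [i] \<longleftrightarrow> i # u @ [i] \<approx> t"
proof -
  have *: "i # (i # w @ [i]) @ [i] \<approx> w" for w
    using pres_cong_append[OF cox_square[OF assms]
        pres_cong_append[OF pres_cong.refl[of _ w] cox_square[OF assms]]]
    by simp
  have **: "i # x @ [i] \<approx> i # y @ [i]" if "x \<approx> y" for x y
    using that by (intro pres_cong_Cons pres_cong_right)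
  show ?thesis
    using **[of u "i # t @ [i]"] *[of t] **[of "i # u @ [i]" t] *[of u]
    by (blast intro: pres_cong.intros)
qed

text \<open>The prefix with \<open>k + 1\<close> letters has the alternating word with
  \<open>2 * k + 1\<close> letters as its reflection. In the induction, conjugation by
  \<open>i\<close> shifts the index \<open>k\<close> of the shorter word to
  \<open>Suc k\<close>.\<close>

lemma parity_alt_word:
  assumes "i \<in> I" and "j \<in> I"
  shows "parity (alt_word n i j) t = odd (card {k. k < n \<and> alt_word (2 * k + 1) i j \<approx> t})"
  using assms
proof (induction n arbitrary: i j t)
  case (Suc n)
  let ?A = "{k. k < n \<and> alt_word (2 * k + 1) j i \<approx> i # t @ [i]}"
  have shift: "alt_word (2 * k + 1) j i \<approx> i # t @ [i] \<longleftrightarrow> alt_word (2 * Suc k + 1) i j \<approx> t" for k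
    using cox_conj_iff[OF Suc.prems(1), of "alt_word (2 * k + 1) j i" t]
      alt_word_snoc[of "2 * k + 1" j i] by simp
  have "{k. k < Suc n \<and> alt_word (2 * k + 1) i j \<approx> t} =
      (if [i] \<approx> t then {0} else {}) \<union> Suc ` ?A"
  proof (rule Set.set_eqI)
    fix k
    show "k \<in> {k. k < Suc n \<and> alt_word (2 * k + 1) i j \<approx> t} \<longleftrightarrow>
        k \<in> (if [i] \<approx> t then {0} else {}) \<union> Suc ` ?A"
      using shift by (cases k) (auto simp: image_iff)
  qed
  moreover have "card (Suc ` ?A) = card ?A"
    by (rule card_image) simp
  moreover have "card ((if [i] \<approx> t then {0} else {}) \<union> Suc ` ?A) =
      (if [i] \<approx> t then 1 else 0) + card (Suc ` ?A)"
    by (subst card_Un_disjoint) auto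
  ultimately show ?case using Suc.IH[OF Suc.prems(2,1)] by simp
qed simp

text \<open>The reflections attached to \<open>(s\<^sub>i s\<^sub>j)\<^sup>m\<close> repeat with period \<open>m\<close>.\<close>

lemma parity_rel:
  assumes "i \<in> I" and "j \<in> I" and "M i j = enat m"
  shows "\<not> parity (alt_word (2 * m) i j) t"
proof -
  define P where "P k \<longleftrightarrow> alt_word (2 * k + 1) i j \<approx> t" for k
  have "alt_word (2 * (k + m) + 1) i j \<approx> alt_word (2 * k + 1) i j" for k
  proof -
    have "alt_word (2 * m + (2 * k + 1)) i j \<approx> [] @ alt_word (2 * k + 1) i j"
      unfolding alt_word_add[of "2 * m"] using pres_cong_right[OF cox_rel[OF assms]] by simp
    then show ?thesis by (simp add: algebra_simps)
  qed
  then have per: "P (k + m) \<longleftrightarrow> P k" for k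
    unfolding P_def by (blast intro: pres_cong.intros)
  have "{k. k < 2 * m \<and> P k} = {k. k < m \<and> P k} \<union> (\<lambda>k. k + m) ` {k. k < m \<and> P k}"
  proof (rule Set.set_eqI, rule iffI)
    fix k assume k: "k \<in> {k. k < 2 * m \<and> P k}"
    show "k \<in> {k. k < m \<and> P k} \<union> (\<lambda>k. k + m) ` {k. k < m \<and> P k}"
    proof (cases "k < m")
      case False
      then have "P (k - m)" "k = k - m + m" "k - m < m" using k per[of "k - m"] by auto
      then show ?thesis by blast
    qed (use k in blast)
  next
    fix k assume "k \<in> {k. k < m \<and> P k} \<union> (\<lambda>k. k + m) ` {k. k < m \<and> P k}"
    then show "k \<in> {k. k < 2 * m \<and> P k}" using per by auto
  qed
  moreover have "card ((\<lambda>k. k + m) ` {k. k < m \<and> P k}) = card {k. k < m \<and> P k}"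
    by (rule card_image) simp
  ultimately have "card {k. k < 2 * m \<and> P k} = 2 * card {k. k < m \<and> P k}"
    by (simp only:, subst card_Un_disjoint) auto
  then show ?thesis by (simp only: parity_alt_word[OF assms(1,2)] P_def) simp
qed

text \<open>Inserting a relator between \<open>x\<close> and \<open>y\<close> adds reflections that
  cancel in pairs by \<open>parity_rel\<close>. The reflections coming from \<open>y\<close> get
  conjugated by a word that is trivial in the group, so they stay the same.\<close>

lemma parity_invariant:
  assumes "u \<approx> v"
  shows "parity u t = parity v t"
  using assms
proof (induction arbitrary: t)
  case (rel u v x y)
  then obtain i j m where *: "i \<in> I" "j \<in> I" "M i j = enat m" "u = alt_word (2 * m) i j" "v = []"
    by (metis cox_relE)
  have u: "u \<approx> []" using *(4) cox_rel[OF *(1-3)] by simp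
  have "rev u @ w @ u \<approx> w" for w
    using pres_cong_append[OF cox_rev[OF u] pres_cong_append[OF pres_cong.refl[of _ w] u]] by simp
  then have "parity y (rev u @ w @ u) = parity y w" for w
    by (rule parity_cong)
  from this[of "rev x @ t @ x"] show ?case
    using parity_rel[OF *(1-3)] unfolding *(4)[symmetric] by (simp add: parity_append *(5))
qed auto

text \<open>An odd count is nonzero, so \<open>t\<close> is the reflection of some prefix
  \<open>x @ [j]\<close>, and multiplying by it cancels this \<open>j\<close>. This is the strong
  exchange condition.\<close>

lemma parity_delete:
  assumes "parity u t" and "set u \<subseteq> I"
  obtains x j y where "u = x @ j # y" and "t @ u \<approx> x @ y"
  using assms
proof (induction u arbitrary: t thesis)
  case (Cons i u)
  show ?case
  proof (cases "[i] \<approx> t")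
    case True
    then have "t @ i # u \<approx> i # i # u"
      using pres_cong_right[OF pres_cong.sym[OF True], of "i # u"] by simp
    then have "t @ i # u \<approx> [] @ u"
      using cox_Cons_Cons[of i u] Cons.prems by (auto intro: pres_cong.trans)
    then show ?thesis using Cons.prems(1)[of "[]" i u] by simp
  next
    case False
    then have "parity u (i # t @ [i])" using Cons.prems by simp
    then obtain x j y where u: "u = x @ j # y" "(i # t @ [i]) @ u \<approx> x @ y"
      using Cons.IH[of "i # t @ [i]"] Cons.prems(3) by auto
    have "i # (i # t @ [i]) @ u \<approx> i # x @ y"
      using u(2) by (rule pres_cong_Cons)
    moreover have "t @ i # u \<approx> i # i # t @ i # u"
      using cox_Cons_Cons[of i "t @ i # u"] Cons.prems by (auto intro: pres_cong.sym)
    ultimately have "t @ i # u \<approx> (i # x) @ y"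
      by (simp add: pres_cong.trans)
    then show ?thesis using Cons.prems(1)[of "i # x" j y] u(1) by simp
  qed
qed simp

text \<open>The comparison runs over all words of the type; by \<open>cox_set\<close> the congruent
  ones are words over \<open>I\<close> again. \<open>reduced_word_iff\<close> relates this to
  \<open>reduced_word\<close>.\<close>

definition reduced :: "'a list \<Rightarrow> bool" where
  "reduced u \<longleftrightarrow> set u \<subseteq> I \<and> (\<forall>v. v \<approx> u \<longrightarrow> length u \<le> length v)"

lemma reduced_set: "reduced u \<Longrightarrow> set u \<subseteq> I"
  by (simp add: reduced_def)

lemma reduced_le: "reduced u \<Longrightarrow> v \<approx> u \<Longrightarrow> length u \<le> length v"
  by (simp add: reduced_def)

lemma reduced_cong:
  assumes "reduced u" and "u \<approx> v" and "length v \<le> length u"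
  shows "reduced v"
  using assms cox_set[OF assms(2)] unfolding reduced_def
  by (metis order_trans pres_cong.sym pres_cong.trans)

lemma reduced_length: "reduced u \<Longrightarrow> reduced v \<Longrightarrow> u \<approx> v \<Longrightarrow> length u = length v"
  by (metis antisym pres_cong.sym reduced_le)

lemma reduced_appendD:
  assumes "reduced (x @ y)"
  shows "reduced x" and "reduced y"
proof -
  have "length x \<le> length v" if "v \<approx> x" for v
    using reduced_le[OF assms pres_cong_right[OF that]] by simp
  moreover have "length y \<le> length v" if "v \<approx> y" for v
    using reduced_le[OF assms pres_cong_left[OF that]] by simp
  ultimately show "reduced x" "reduced y"
    using reduced_set[OF assms] by (auto simp: reduced_def)
qed

lemma not_reduced_repeat: "\<not> reduced (x @ i # i # y)"
proof
  assume red: "reduced (x @ i # i # y)"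
  then have "i # i # y \<approx> y" using reduced_set cox_Cons_Cons by fastforce
  then have "x @ y \<approx> x @ i # i # y" using pres_cong_left pres_cong.sym by metis
  from reduced_le[OF red this] show False by simp
qed

lemma ex_reduced:
  assumes "set u \<subseteq> I"
  obtains v where "reduced v" and "v \<approx> u"
proof -
  obtain v where "v \<approx> u" "\<And>w. w \<approx> u \<Longrightarrow> length v \<le> length w"
    using ex_has_least_nat[of "\<lambda>v. v \<approx> u" u length] pres_cong.refl by metis
  then have "reduced v"
    using assms cox_set unfolding reduced_def by (metis pres_cong.trans)
  with \<open>v \<approx> u\<close> show thesis by (rule that[rotated])
qed

text \<open>The first prefix contributes the reflection \<open>i\<close> once. If the total were
  even, \<open>i\<close> would occur oddly in \<open>v\<close>, and a deletion in \<open>v\<close>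
  would give a word for \<open>i # v\<close> that is too short.\<close>

lemma parity_head:
  assumes "reduced (i # v)"
  shows "parity (i # v) [i]"
proof (rule ccontr)
  have i: "i \<in> I" "set v \<subseteq> I" using reduced_set[OF assms] by auto
  assume "\<not> parity (i # v) [i]"
  then have "parity v [i, i, i]" by (simp add: pres_cong.refl)
  then have "parity v [i]" using parity_cong[OF cox_Cons_Cons[OF i(1), of "[i]"]] by simp
  then obtain x j y where "v = x @ j # y" "[i] @ v \<approx> x @ y"
    using parity_delete i(2) by blast
  then show False using reduced_le[OF assms, of "x @ y"] pres_cong.sym by fastforce
qed

lemma exchange:
  assumes "reduced u" and "reduced (i # v)" and "u \<approx> i # v"
  obtains x j y where "u = x @ j # y" and "i # x @ y \<approx> u" and "reduced (i # x @ y)"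
proof -
  have "parity u [i]" using parity_head[OF assms(2)] parity_invariant[OF assms(3)] by simp
  then obtain x j y where u: "u = x @ j # y" "[i] @ u \<approx> x @ y"
    using parity_delete reduced_set[OF assms(1)] by blast
  have "i # i # u \<approx> i # x @ y" using u(2) pres_cong_Cons by fastforce
  then have "i # x @ y \<approx> u"
    using cox_Cons_Cons[of i u] reduced_set[OF assms(2)]
    by (auto intro: pres_cong.trans pres_cong.sym)
  moreover have "reduced (i # x @ y)"
    using reduced_cong[OF assms(1) pres_cong.sym[OF calculation]] u(1) by simp
  ultimately show thesis using that u(1) by blast
qed

text \<open>The plan is to show that \<open>u\<close> has a reduced word starting with
  \<open>i\<close>; then \<open>exchange\<close> finds that word inside \<open>u\<close>.\<close>

lemma descent:
  assumes "reduced u" and "i \<in> I" and "\<not> reduced (i # u)"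
  obtains x j y where "u = x @ j # y" and "i # x @ y \<approx> u" and "reduced (i # x @ y)"
    and "i # u \<approx> x @ y" and "reduced (x @ y)"
proof -
  obtain v where v: "reduced v" "v \<approx> i # u"
    using ex_reduced[of "i # u"] reduced_set[OF assms(1)] assms(2) by auto
  have "length v \<le> length (i # u)"
    using reduced_le[OF v(1)] v(2) by (blast intro: pres_cong.sym)
  moreover have "length v \<noteq> length (i # u)"
    using reduced_cong[OF v] assms(3) by auto
  ultimately have le: "length v \<le> length u" by simp
  have iv: "i # v \<approx> u"
    using pres_cong_Cons[OF v(2), of i] cox_Cons_Cons[OF assms(2), of u]
    by (rule pres_cong.trans)
  \<comment> \<open>So far \<open>v\<close> could still be as long as \<open>u\<close>. The parity
    of the reflection \<open>i\<close> excludes this: if odd in \<open>v\<close>, a deletion gives a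
    word for \<open>u\<close> shorter than \<open>u\<close>, which is absurd; if even, it is odd in
    \<open>u\<close>, and a deletion in \<open>u\<close> bounds the length of
    \<open>v\<close>.\<close>
  have red: "reduced (i # v)"
  proof (cases "parity v [i]")
    case True
    then obtain x j y where "v = x @ j # y" "[i] @ v \<approx> x @ y"
      using parity_delete reduced_set[OF v(1)] by blast
    then have "x @ y \<approx> u" "length (x @ y) < length u"
      using iv le by (auto intro: pres_cong.trans pres_cong.sym)
    then show ?thesis using reduced_le[OF assms(1)] by fastforce
  next
    case False
    have "\<not> parity (i # u) [i]" using False parity_invariant[OF v(2)] by simp
    then have "parity u [i, i, i]" by (simp add: pres_cong.refl)
    then have "parity u [i]" using parity_cong[OF cox_Cons_Cons[OF assms(2), of "[i]"]] by simp
    then obtain x j y where u: "u = x @ j # y" "[i] @ u \<approx> x @ y"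
      using parity_delete reduced_set[OF assms(1)] by blast
    have "x @ y \<approx> v" using v(2) u(2) by (auto intro: pres_cong.trans pres_cong.sym)
    then have "length v \<le> length (x @ y)" by (rule reduced_le[OF v(1)])
    then have "length (i # v) \<le> length u" using u(1) by simp
    then show ?thesis using reduced_cong[OF assms(1) pres_cong.sym[OF iv]] by simp
  qed
  obtain x j y where u: "u = x @ j # y" "i # x @ y \<approx> u" "reduced (i # x @ y)"
    using exchange[OF assms(1) red pres_cong.sym[OF iv]] .
  moreover have "i # u \<approx> x @ y"
    using pres_cong_Cons[OF u(2), of i] cox_Cons_Cons[OF assms(2), of "x @ y"]
    by (blast intro: pres_cong.intros)
  moreover have "reduced (x @ y)" using reduced_appendD(2)[of "[i]"] u(3) by simp
  ultimately show thesis using that by blast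
qed

text \<open>The word is reduced one letter at a time by \<open>descent\<close>, which only deletes
  letters. Hence an element of a parabolic subgroup has a reduced word in the generators of that
  subgroup.\<close>

lemma ex_reduced_subset:
  assumes "set u \<subseteq> I"
  obtains v where "reduced v" and "v \<approx> u" and "set v \<subseteq> set u"
  using assms
proof (induction u arbitrary: thesis)
  case Nil
  then show ?case by (auto simp: reduced_def intro: pres_cong.refl)
next
  case (Cons i u)
  then obtain v where v: "reduced v" "v \<approx> u" "set v \<subseteq> set u" by auto
  have iv: "i # v \<approx> i # u" using v(2) by (rule pres_cong_Cons)
  show ?case
  proof (cases "reduced (i # v)")
    case True
    then show ?thesis using Cons.prems(1)[of "i # v"] iv v(3) by auto
  next
    case False
    have "i \<in> I" using Cons.prems(2) by simp
    from descent[OF v(1) this False] obtain x j y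
      where "v = x @ j # y" "i # v \<approx> x @ y" "reduced (x @ y)" by metis
    then show ?thesis
      using Cons.prems(1)[of "x @ y"] pres_cong.trans[OF pres_cong.sym iv] v(3) by auto
  qed
qed

section \<open>The order of a product of two generators\<close>

text \<open>
  The contragredient geometric representation, in the coordinates dual to the simple roots. The
  value at \<open>i = j\<close> is \<open>- cos \<pi> = 1\<close>.
\<close>

definition form :: "'a \<Rightarrow> 'a \<Rightarrow> real" where
  "form i j = (case M i j of enat m \<Rightarrow> - cos (pi / m) | \<infinity> \<Rightarrow> - 1)"

definition reflect :: "'a \<Rightarrow> ('a \<Rightarrow> real) \<Rightarrow> 'a \<Rightarrow> real" where
  "reflect i f = (\<lambda>k. f k - 2 * form i k * f i)"

lemma form_diag: "i \<in> I \<Longrightarrow> form i i = 1"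
  by (simp add: form_def M_diag one_enat_def)

lemma form_sym: "i \<in> I \<Longrightarrow> j \<in> I \<Longrightarrow> form i j = form j i"
  by (simp add: form_def M_sym)

lemma reflect_pair:
  assumes "i \<in> I" and "j \<in> I"
  shows "(reflect i \<circ> reflect j) f i = - f i + 2 * form i j * f j"
    and "(reflect i \<circ> reflect j) f j =
      - f j + 2 * form i j * (- f i + 2 * form i j * f j)"
  by (simp_all add: reflect_def form_diag assms form_sym[OF assms(2,1)] algebra_simps)

text \<open>On these two coordinates the product acts like a rotation by
  \<open>2 * \<theta>\<close>. The coefficients are quotients of sines by
  \<open>sin \<theta>\<close>; with the denominator cleared, the induction only uses the three-term
  recurrence \<open>rec\<close>.\<close>

lemma reflect_pair_power:
  fixes \<theta> :: real
  assumes "i \<in> I" and "j \<in> I" and "form i j = - cos \<theta>"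
  shows "((reflect i \<circ> reflect j) ^^ n) f i * sin \<theta> =
      - f j * sin (2 * n * \<theta>) - f i * sin (2 * n * \<theta> - \<theta>) \<and>
    ((reflect i \<circ> reflect j) ^^ n) f j * sin \<theta> =
      f j * sin (2 * n * \<theta> + \<theta>) + f i * sin (2 * n * \<theta>)"
proof (induction n)
  case (Suc n)
  define T where "T = reflect i \<circ> reflect j"
  define g where "g = (T ^^ n) f"
  define a where "a = 2 * real n * \<theta>"
  have step: "(T ^^ Suc n) f = T g"
    by (simp add: g_def)
  have IH: "g i * sin \<theta> = - f j * sin a - f i * sin (a - \<theta>)"
    "g j * sin \<theta> = f j * sin (a + \<theta>) + f i * sin a"
    using Suc unfolding g_def a_def T_def by blast+
  have rec: "sin (x + \<theta>) = 2 * cos \<theta> * sin x - sin (x - \<theta>)" for x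
    by (simp add: sin_add sin_diff)
  have r1: "sin (a + \<theta>) = 2 * cos \<theta> * sin a - sin (a - \<theta>)"
    by (rule rec)
  have r2: "sin (a + 2 * \<theta>) = 2 * cos \<theta> * sin (a + \<theta>) - sin a"
    using rec[of "a + \<theta>"] by (simp add: algebra_simps)
  have r3: "sin (a + 3 * \<theta>) = 2 * cos \<theta> * sin (a + 2 * \<theta>) - sin (a + \<theta>)"
    using rec[of "a + 2 * \<theta>"] by (simp add: algebra_simps)
  have i: "(- g i + 2 * form i j * g j) * sin \<theta> = - f j * sin (a + 2 * \<theta>) - f i * sin (a + \<theta>)"
    using IH r1 r2 unfolding assms(3) by algebra
  have "(- g j + 2 * form i j * (- g i + 2 * form i j * g j)) * sin \<theta> =
      f j * sin (a + 3 * \<theta>) + f i * sin (a + 2 * \<theta>)"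
    using IH r1 r2 r3 unfolding assms(3) by algebra
  moreover have "2 * real (Suc n) * \<theta> = a + 2 * \<theta>" by (simp add: a_def algebra_simps)
  ultimately show ?case
    using i unfolding T_def[symmetric] step unfolding T_def reflect_pair[OF assms(1,2)]
    by (simp add: algebra_simps)
qed (simp add: algebra_simps)

text \<open>This is the limit of \<open>reflect_pair_power\<close> for \<open>\<theta>\<close>
  tending to 0: the quotients of sines become linear in \<open>n\<close>.\<close>

lemma reflect_pair_power_infinite:
  assumes "i \<in> I" and "j \<in> I" and "form i j = - 1"
  shows "((reflect i \<circ> reflect j) ^^ n) f i = - f j * (2 * real n) - f i * (2 * real n - 1) \<and>
    ((reflect i \<circ> reflect j) ^^ n) f j = f j * (2 * real n + 1) + f i * (2 * real n)"
proof (induction n)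
  case (Suc n)
  define T where "T = reflect i \<circ> reflect j"
  have "(T ^^ Suc n) f = T ((T ^^ n) f)" by simp
  then show ?case
    using Suc.IH reflect_pair[OF assms(1,2), of "(T ^^ n) f"] unfolding T_def[symmetric]
    by (simp add: assms(3) algebra_simps)
qed simp

text \<open>
  Modulo a suitable combination of the \<open>i\<close>th and \<open>j\<close>th coordinates, every other coordinate is
  fixed by both reflections, so only these two coordinates have to be followed.
\<close>

lemma reflect_rel:
  assumes "i \<in> I" and "j \<in> I" and "M i j = enat m"
  shows "((reflect i \<circ> reflect j) ^^ m) f = f"
proof (cases "i = j")
  case True
  then have "m = 1" using assms M_diag by (simp add: one_enat_def)
  then show ?thesis
    using True assms(1) by (simp add: fun_eq_iff reflect_def form_diag algebra_simps)
next
  case False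
  then have m: "2 \<le> m" using M_ge_2[OF assms(1,2)] assms(3) by (simp add: numeral_eq_enat)
  define \<theta> where "\<theta> = pi / m"
  let ?T = "reflect i \<circ> reflect j"
  have form: "form i j = - cos \<theta>" using assms(3) by (simp add: form_def \<theta>_def)
  have sin: "sin \<theta> > 0" unfolding \<theta>_def using m by (rule sin_pi_div_pos)
  have period: "2 * real m * \<theta> = 2 * pi" using m by (simp add: \<theta>_def)
  have "sin (2 * real m * \<theta>) = 0" "sin (2 * real m * \<theta> + \<theta>) = sin \<theta>"
      "sin (2 * real m * \<theta> - \<theta>) = - sin \<theta>"
    unfolding sin_add sin_diff period by simp_all
  then have ij: "(?T ^^ m) f i = f i" "(?T ^^ m) f j = f j"
    using reflect_pair_power[OF assms(1,2) form, of m f] sin by auto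
  show ?thesis
  proof
    fix k
    \<comment> \<open>\<open>D\<close> is the Gram determinant of the two roots, equal to the square
      of \<open>sin \<theta>\<close>. The coefficients \<open>\<alpha>\<close> and
      \<open>\<beta>\<close> solve the linear system \<open>inv\<close> by Cramer's rule.\<close>
    define D where "D = 1 - (form i j)\<^sup>2"
    have D: "D \<noteq> 0" using sin sin_squared_eq[of \<theta>] by (auto simp: D_def form)
    define \<alpha> where "\<alpha> = (form i j * form j k - form i k) / D"
    define \<beta> where "\<beta> = (form i j * form i k - form j k) / D"
    have "\<alpha> * D = form i j * form j k - form i k" "\<beta> * D = form i j * form i k - form j k"
      using D by (simp_all add: \<alpha>_def \<beta>_def)
    then have "(form i k + \<alpha> + \<beta> * form i j) * D = 0" "(form j k + \<alpha> * form i j + \<beta>) * D = 0"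
      unfolding D_def by algebra+
    then have inv: "form i k + \<alpha> + \<beta> * form i j = 0" "form j k + \<alpha> * form i j + \<beta> = 0"
      using D by simp_all
    define F where "F g = g k + \<alpha> * g i + \<beta> * g j" for g :: "'a \<Rightarrow> real"
    have "F (reflect i g) = F g" for g
    proof -
      have "F (reflect i g) = F g - 2 * (form i k + \<alpha> + \<beta> * form i j) * g i"
        by (simp add: F_def reflect_def form_diag assms algebra_simps)
      then show ?thesis using inv by simp
    qed
    moreover have "F (reflect j g) = F g" for g
    proof -
      have "F (reflect j g) = F g - 2 * (form j k + \<alpha> * form i j + \<beta>) * g j"
        by (simp add: F_def reflect_def form_diag form_sym[OF assms(2,1)] assms algebra_simps)
      then show ?thesis using inv by simp
    qed
    ultimately have "F ((?T ^^ n) f) = F f" for n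
      by (induction n) simp_all
    from this[of m] show "(?T ^^ m) f k = f k" unfolding F_def ij by simp
  qed
qed

lemma reflect_invariant:
  assumes "u \<approx> v"
  shows "foldr reflect u f = foldr reflect v f"
  using assms
proof (induction arbitrary: f)
  case (rel u v x y)
  then obtain i j m where "i \<in> I" "j \<in> I" "M i j = enat m" "u = alt_word (2 * m) i j" "v = []"
    by (metis cox_relE)
  then show ?case using reflect_rel by (simp add: foldr_alt_word)
qed auto

text \<open>The action on one coordinate vector bounds the order from below. If it returns after
  \<open>n\<close> steps, then \<open>n * \<theta>\<close> is a zero of the sine, which is
  impossible strictly between 0 and \<open>pi\<close>; for \<open>M i j = \<infinity>\<close> the
  linear growth excludes any return.\<close>

lemma order_ge:
  assumes "i \<in> I" and "j \<in> I" and "i \<noteq> j" and "0 < n" and "alt_word (2 * n) i j \<approx> []"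
  shows "M i j \<le> enat n"
proof (rule ccontr)
  define f where "f k = (if k = j then 1 else 0 :: real)" for k
  have f: "f i = 0" "f j = 1" using assms(3) by (auto simp: f_def)
  have *: "((reflect i \<circ> reflect j) ^^ n) f = f"
    using reflect_invariant[OF assms(5), of f] by (simp add: foldr_alt_word)
  assume less: "\<not> M i j \<le> enat n"
  show False
  proof (cases "M i j")
    case (enat m)
    then have m: "2 \<le> m" "n < m"
      using M_ge_2[OF assms(1-3)] less by (simp_all add: numeral_eq_enat)
    define \<theta> where "\<theta> = pi / m"
    have form: "form i j = - cos \<theta>" using enat by (simp add: form_def \<theta>_def)
    have sin: "sin \<theta> > 0" unfolding \<theta>_def using m(1) by (rule sin_pi_div_pos)
    have s: "sin (2 * n * \<theta>) = 0" "sin (2 * n * \<theta> + \<theta>) = sin \<theta>"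
      using reflect_pair_power[OF assms(1,2) form, of n f] by (simp_all add: * f)
    then have "cos (2 * n * \<theta>) = 1" using sin by (simp add: sin_add)
    then have "sin (n * \<theta>) = 0" using cos_double_sin[of "n * \<theta>"] by (simp add: mult.assoc)
    moreover have "0 < n * \<theta>" "n * \<theta> < pi"
      using m assms(4) by (simp_all add: \<theta>_def field_simps)
    ultimately show False using sin_gt_zero by force
  next
    case infinity
    then have "form i j = - 1" by (simp add: form_def)
    then show False
      using reflect_pair_power_infinite[OF assms(1,2), of n f] assms(4) by (simp add: * f)
  qed
qed

section \<open>Matsumoto's theorem\<close>

lemma hecke_idem: "i \<in> I \<Longrightarrow> i # i # u \<simeq> i # u"
  using pres_cong_right[OF pres_cong_base, of "[i, i]" "[i]" "hecke_rels I M" u]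
  by (auto simp: hecke_rels_def)

lemma hecke_braid:
  "i \<in> I \<Longrightarrow> j \<in> I \<Longrightarrow> i \<noteq> j \<Longrightarrow> M i j = enat m \<Longrightarrow> alt_word m i j \<simeq> alt_word m j i"
  by (rule pres_cong_base) (auto simp: hecke_rels_def)

text \<open>Exchange puts \<open>i\<close> in front and deletes one letter. Deleted from
  \<open>z\<close>, it leaves a longer alternating prefix. Deleted at the end of the prefix, it
  yields a braid relation of length \<open>n\<close>, contrary to \<open>order_ge\<close>. Deleted
  earlier, it makes two equal letters meet in a reduced word.\<close>

lemma alt_word_Suc_exchange:
  assumes "i \<in> I" and "j \<in> I" and "i \<noteq> j" and "0 < n" and "\<not> M i j \<le> enat n"
    and "reduced (alt_word n j i @ z)" and "reduced (i # v)" and "alt_word n j i @ z \<approx> i # v"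
  obtains z' where "reduced (alt_word (Suc n) i j @ z')" "alt_word (Suc n) i j @ z' \<approx> i # v"
proof -
  obtain x l y where *: "alt_word n j i @ z = x @ l # y" "i # x @ y \<approx> alt_word n j i @ z"
      "reduced (i # x @ y)"
    using exchange[OF assms(6-8)] .
  define p where "p = length x"
  show thesis
  proof (cases "n \<le> p")
    case True
    have "alt_word n j i = take n (alt_word n j i @ z)" by simp
    also have "\<dots> = take n x" using True unfolding *(1) by (simp add: p_def)
    finally have "x = alt_word n j i @ drop n x" by simp
    then obtain x' where "x = alt_word n j i @ x'" ..
    then show thesis
      using that[of "x' @ y"] *(2,3) assms(8) by (auto intro: pres_cong.trans)
  next
    case False
    \<comment> \<open>The number of letters of the alternating prefix behind the deleted
      one.\<close>
    define q where "q = n - Suc p"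
    have n: "n = Suc p + q" using False by (simp add: q_def)
    have split: "alt_word n j i = alt_word p j i @ (if even p then j else i) #
        (if even p then alt_word q i j else alt_word q j i)"
      unfolding n alt_word_add[of "Suc p"] alt_word_snoc[of p] by simp
    have x: "x = alt_word p j i"
      and y: "y = (if even p then alt_word q i j else alt_word q j i) @ z"
      using *(1) unfolding split by (simp_all add: append_eq_append_conv p_def)
    have ix: "i # x = alt_word p i j @ [if even p then i else j]"
      using alt_word_snoc[of p i j] by (simp add: x)
    show thesis
    proof (cases q)
      case 0
      then have "alt_word n i j @ z \<approx> alt_word n j i @ z"
        using *(2) n y by (cases "even p") (simp_all add: x)
      then have "alt_word n i j \<approx> alt_word n j i"
        by (rule cox_cancel_right[rotated]) (use reduced_set[OF assms(6)] in simp)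
      then have "alt_word (2 * n) i j \<approx> []" using cox_alt_word_swap[OF assms(1,2)] by simp
      then show thesis using order_ge[OF assms(1-4)] assms(5) by blast
    next
      case (Suc q')
      then obtain y' where "y = (if even p then i else j) # y'"
        using y by (cases "even p") auto
      then have "i # x @ y =
          alt_word p i j @ (if even p then i else j) # (if even p then i else j) # y'"
        using arg_cong[OF ix, of "\<lambda>w. w @ y"] by simp
      then show thesis using *(3) not_reduced_repeat by metis
    qed
  qed
qed

text \<open>For different first letters \<open>i\<close> and \<open>j\<close>, the element has
  reduced words starting with either side of the braid relation. These link \<open>u\<close> to
  \<open>v\<close>: neighbours in the chain share a first letter or differ by the braid
  relation.\<close>

theorem matsumoto:
  assumes "reduced u" and "reduced v" and "u \<approx> v"
  shows "u \<simeq> v"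
  using assms
proof (induction "length u" arbitrary: u v rule: less_induct)
  case less
  have same: "i # a \<simeq> i # b"
    if "reduced (i # a)" "reduced (i # b)" "i # a \<approx> i # b" "length (i # a) = length u" for i a b
  proof -
    have "i \<in> I" using reduced_set[OF that(1)] by simp
    then have "a \<approx> b" using that(3) cox_cancel_Cons by blast
    moreover have "reduced a" "reduced b"
      using reduced_appendD(2)[of "[i]"] that(1,2) by auto
    ultimately show ?thesis using less.hyps[of a b] that(4) by (auto intro: pres_cong_Cons)
  qed
  have len: "length v = length u" using reduced_length less.prems by metis
  show ?case
  proof (cases u)
    case Nil
    then show ?thesis using len by (simp add: pres_cong.refl)
  next
    case (Cons i u')
    then obtain j v' where v: "v = j # v'" using len by (cases v) auto
    show ?thesis
    proof (cases "i = j")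
      case True
      then show ?thesis using same[of i u' v'] less.prems Cons v by simp
    next
      case False
      have red: "reduced (i # u')" "reduced (j # v')" "i # u' \<approx> j # v'"
        using less.prems Cons v by auto
      have ij: "i \<in> I" "j \<in> I" using reduced_set[OF red(1)] reduced_set[OF red(2)] by auto
      let ?P = "\<lambda>n. (\<exists>z. reduced (alt_word n i j @ z) \<and> alt_word n i j @ z \<approx> i # u') \<and>
        (\<exists>z. reduced (alt_word n j i @ z) \<and> alt_word n j i @ z \<approx> i # u')"
      \<comment> \<open>The words \<open>u\<close> and \<open>v\<close> themselves start the
        induction. Each prefix is lengthened by an exchange in the word with the other prefix, so
        both are carried along.\<close>
      have step: "?P (Suc n)" if "enat (Suc n) \<le> M i j" for n
        using that
      proof (induction n)
        case 0
        then show ?case using red by (auto intro: pres_cong.intros)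
      next
        case (Suc n)
        have "enat (Suc n) < enat (Suc (Suc n))" by simp
        then have "enat (Suc n) < M i j" using Suc.prems by (rule order.strict_trans2)
        then have less: "\<not> M i j \<le> enat (Suc n)" "\<not> M j i \<le> enat (Suc n)"
          using M_sym[OF ij] by (simp_all add: not_le)
        from Suc.IH less have "?P (Suc n)" by simp
        then obtain z1 z2 where z: "reduced (alt_word (Suc n) i j @ z1)"
            "alt_word (Suc n) i j @ z1 \<approx> i # u'"
            "reduced (alt_word (Suc n) j i @ z2)" "alt_word (Suc n) j i @ z2 \<approx> i # u'"
          by blast
        obtain z1' where 1: "reduced (alt_word (Suc (Suc n)) i j @ z1')"
            "alt_word (Suc (Suc n)) i j @ z1' \<approx> i # u'"
          using alt_word_Suc_exchange[OF ij False _ less(1) z(3) red(1) z(4)] by blast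
        obtain z2' where 2: "reduced (alt_word (Suc (Suc n)) j i @ z2')"
            "alt_word (Suc (Suc n)) j i @ z2' \<approx> j # v'"
          using alt_word_Suc_exchange[OF ij(2,1) _ _ less(2) z(1) red(2)
              pres_cong.trans[OF z(2) red(3)]] False by blast
        show ?case using 1 2 red(3) by (blast intro: pres_cong.intros)
      qed
      have bound: "n \<le> length u" if "?P n" for n
        using that reduced_length[OF _ red(1)] Cons by fastforce
      \<comment> \<open>Otherwise the alternating prefixes would outgrow the length of
        \<open>u\<close>.\<close>
      have "M i j \<noteq> \<infinity>"
      proof
        assume "M i j = \<infinity>"
        then have "Suc (length u) \<le> length u" by (intro bound step) simp
        then show False by simp
      qed
      then obtain m where M: "M i j = enat m" by auto
      have "2 \<le> m" using M_ge_2[OF ij False] M by (simp add: numeral_eq_enat)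
      then obtain m' where m: "m = Suc m'" by (cases m) auto
      obtain z where z: "reduced (alt_word m i j @ z)" "alt_word m i j @ z \<approx> i # u'"
        using step[of m'] M m by auto
      have swap: "alt_word m i j \<approx> alt_word m j i"
        using cox_alt_word_swap[OF ij] cox_rel[OF ij M] by simp
      have zj: "alt_word m j i @ z \<approx> j # v'"
        using pres_cong_right[OF swap, of z] z(2) red(3) by (blast intro: pres_cong.intros)
      have zj_red: "reduced (alt_word m j i @ z)"
        using reduced_cong[OF z(1) pres_cong_right[OF swap]] by simp
      have "i # u' \<simeq> alt_word m i j @ z"
        using same[of i u' "alt_word m' j i @ z"] red(1) z Cons m by (auto intro: pres_cong.sym)
      moreover have "alt_word m i j @ z \<simeq> alt_word m j i @ z"
        by (rule pres_cong_right[OF hecke_braid[OF ij False M]])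
      moreover have "alt_word m j i @ z \<simeq> j # v'"
        using same[of j "alt_word m' i j @ z" v'] red(2) zj zj_red len v m
          reduced_length[OF zj_red red(2) zj] by auto
      ultimately show ?thesis unfolding Cons v by (blast intro: pres_cong.trans)
    qed
  qed
qed

section \<open>Subwords as an invariant of the Hecke monoid\<close>

lemma hecke_relE:
  assumes "(u, v) \<in> hecke_rels I M"
  obtains i where "i \<in> I" "u = [i, i]" "v = [i]"
  | i j m where "i \<in> I" "j \<in> I" "i \<noteq> j" "M i j = enat m" "2 \<le> m"
      "u = alt_word m i j" "v = alt_word m j i"
  using assms M_ge_2 by (auto simp: hecke_rels_def numeral_eq_enat) fastforce

lemma hecke_set:
  assumes "u \<simeq> v"
  shows "set u = set v"
  using assms
proof induction
  case (rel u v x y)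
  then show ?case by (rule hecke_relE) (auto simp: set_alt_word_eq)
qed auto

lemma hecke_rev:
  assumes "u \<simeq> v"
  shows "rev u \<simeq> rev v"
proof (rule pres_cong_rev[OF assms])
  fix u v assume uv: "(u, v) \<in> hecke_rels I M"
  from uv show "rev u \<simeq> rev v"
  proof (rule hecke_relE)
    fix i assume "i \<in> I" "u = [i, i]" "v = [i]"
    then show ?thesis using pres_cong_base[OF uv] by simp
  next
    fix i j m assume "u = alt_word m i j" "v = alt_word m j i"
    then show ?thesis
      using pres_cong_base[OF uv] by (auto simp: rev_alt_word intro: pres_cong.sym)
  qed
qed

text \<open>If \<open>i # v\<close> is not reduced, then \<open>v\<close> has a reduced word
  starting with \<open>i\<close>. By Matsumoto's theorem \<open>v\<close> is Hecke-equal to that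
  word, so the idempotent \<open>i\<close> is absorbed.\<close>

lemma ex_hecke_reduced:
  assumes "set u \<subseteq> I"
  obtains v where "reduced v" and "v \<simeq> u"
  using assms
proof (induction u arbitrary: thesis)
  case Nil
  then show ?case using Nil(1)[of "[]"] by (simp add: reduced_def pres_cong.refl)
next
  case (Cons i u)
  then obtain v where v: "reduced v" "v \<simeq> u" by auto
  have i: "i \<in> I" using Cons.prems(2) by simp
  have iv: "i # v \<simeq> i # u" using v(2) by (rule pres_cong_Cons)
  show ?case
  proof (cases "reduced (i # v)")
    case True
    then show ?thesis using Cons.prems(1)[of "i # v"] iv by simp
  next
    case False
    from descent[OF v(1) i this] obtain x y where "i # x @ y \<approx> v" "reduced (i # x @ y)"
      by metis
    then have *: "v \<simeq> i # x @ y" using matsumoto v(1) by (blast intro: pres_cong.sym)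
    have "i # v \<simeq> v"
      using pres_cong_Cons[OF *, of i] hecke_idem[OF i, of "x @ y"] pres_cong.sym[OF *]
      by (blast intro: pres_cong.trans)
    then show ?thesis using Cons.prems(1)[of v] v(1) iv by (blast intro: pres_cong.intros)
  qed
qed

text \<open>Closing under \<open>\<approx>\<close> turns a set of words into a set of group
  elements. For a reduced word this is the lower Bruhat interval of its element.\<close>

definition subwords :: "'a list \<Rightarrow> 'a list set" where
  "subwords u = {w. \<exists>u'. subseq u' u \<and> w \<approx> u'}"

lemma subwords_append:
  "subwords (u @ v) = {w. \<exists>a\<in>subwords u. \<exists>b\<in>subwords v. w \<approx> a @ b}"
proof (rule Set.set_eqI, rule iffI)
  fix w assume "w \<in> subwords (u @ v)"
  then obtain a b where "subseq a u" "subseq b v" "w \<approx> a @ b"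
    by (auto simp: subwords_def elim: subseq_appendE)
  then show "w \<in> {w. \<exists>a\<in>subwords u. \<exists>b\<in>subwords v. w \<approx> a @ b}"
    by (auto simp: subwords_def intro: pres_cong.refl)
next
  fix w assume "w \<in> {w. \<exists>a\<in>subwords u. \<exists>b\<in>subwords v. w \<approx> a @ b}"
  then obtain a b a' b' where "subseq a' u" "subseq b' v" "a \<approx> a'" "b \<approx> b'" "w \<approx> a @ b"
    by (auto simp: subwords_def)
  then show "w \<in> subwords (u @ v)"
    unfolding subwords_def by (blast intro: pres_cong.trans pres_cong_append list_emb_append_mono)
qed

lemma subwords_mono: "subseq u v \<Longrightarrow> subwords u \<subseteq> subwords v"
  unfolding subwords_def by (blast intro: subseq_order.order_trans)

lemma self_in_subwords: "u \<in> subwords u"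
  unfolding subwords_def by (auto intro: pres_cong.refl)

text \<open>After deletions, equal letters that meet cancel in pairs, which leaves an alternating
  word. One that starts with \<open>j\<close> has lost at least the first letter, hence the strict
  bound.\<close>

lemma subseq_alt_word:
  assumes "i \<in> I" and "j \<in> I" and "subseq u (alt_word n i j)"
  shows "\<exists>k. k \<le> n \<and> u \<approx> alt_word k i j \<or> k < n \<and> u \<approx> alt_word k j i"
  using assms
proof (induction n arbitrary: u i j)
  case 0
  then show ?case by (cases u) (auto intro!: exI[of _ 0] pres_cong.refl)
next
  case (Suc n)
  show ?case
  proof (cases "subseq u (alt_word n j i)")
    case True
    then obtain k where "k \<le> n \<and> u \<approx> alt_word k j i \<or> k < n \<and> u \<approx> alt_word k i j"
      using Suc.IH[OF Suc.prems(2,1)] by blast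
    then show ?thesis by (intro exI[of _ k]) auto
  next
    case False
    have "subseq u (i # alt_word n j i)" using Suc.prems(3) by simp
    then obtain w where w: "u = i # w" "subseq w (alt_word n j i)"
      using False by (cases u) (auto simp: subseq_Cons2_iff split: if_splits)
    then obtain k where "k \<le> n \<and> w \<approx> alt_word k j i \<or> k < n \<and> w \<approx> alt_word k i j"
      using Suc.IH[OF Suc.prems(2,1)] by blast
    then consider "k \<le> n" "w \<approx> alt_word k j i" | "k < n" "w \<approx> alt_word k i j" by blast
    then show ?thesis
    proof cases
      case 1
      then have "u \<approx> alt_word (Suc k) i j" using w(1) by (simp add: pres_cong_Cons)
      then show ?thesis using 1 by (intro exI[of _ "Suc k"]) simp
    next
      case 2
      then have iw: "u \<approx> i # alt_word k i j" using w(1) by (simp add: pres_cong_Cons)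
      show ?thesis
      proof (cases k)
        case 0
        then show ?thesis using iw by (intro exI[of _ "Suc 0"]) simp
      next
        case (Suc k')
        then have "u \<approx> alt_word k' j i"
          using iw cox_Cons_Cons[OF Suc.prems(1)] by (auto intro: pres_cong.trans)
        then show ?thesis using 2 Suc by (intro exI[of _ k']) simp
      qed
    qed
  qed
qed

lemma alt_word_in_subwords:
  assumes "k \<le> n"
  shows "alt_word k i j \<in> subwords (alt_word n i j)"
proof -
  have "subseq (alt_word k i j) (alt_word n i j)"
    using alt_word_add[of k "n - k" i j] assms
    by (simp add: subseq_rev_drop_many del: subseq_append)
  then show ?thesis using subwords_mono self_in_subwords by blast
qed

lemma subwords_cong: "w \<in> subwords u \<Longrightarrow> w' \<approx> w \<Longrightarrow> w' \<in> subwords u"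
  unfolding subwords_def by (blast intro: pres_cong.trans)

lemma subwords_braid:
  assumes "i \<in> I" and "j \<in> I" and "M i j = enat m"
  shows "subwords (alt_word m i j) \<subseteq> subwords (alt_word m j i)"
proof
  fix w assume "w \<in> subwords (alt_word m i j)"
  then obtain u where u: "subseq u (alt_word m i j)" "w \<approx> u"
    unfolding subwords_def by blast
  then obtain k where "k \<le> m \<and> u \<approx> alt_word k i j \<or> k < m \<and> u \<approx> alt_word k j i"
    using subseq_alt_word assms by blast
  then consider "k = m" "u \<approx> alt_word m i j" | "k < m" "u \<approx> alt_word k i j"
    | "k < m" "u \<approx> alt_word k j i"
    by (auto simp: le_less)
  then have "u \<in> subwords (alt_word m j i)"
  proof cases
    case 1
    have "alt_word m i j \<approx> alt_word m j i"
      using cox_alt_word_swap[OF assms(1,2)] cox_rel[OF assms] by simp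
    then show ?thesis using 1 self_in_subwords subwords_cong pres_cong.trans by metis
  next
    case 2
    then obtain m' where m: "m = Suc m'" "k \<le> m'" by (cases m) auto
    have "alt_word k i j \<in> subwords (alt_word m' i j)" using m(2) by (rule alt_word_in_subwords)
    moreover have "subseq (alt_word m' i j) (alt_word m j i)" by (simp add: m(1) list_emb_Cons)
    ultimately show ?thesis using 2(2) subwords_mono subwords_cong by blast
  next
    case 3
    then show ?thesis using alt_word_in_subwords[of k m j i] subwords_cong by simp
  qed
  then show "w \<in> subwords (alt_word m j i)" using u(2) subwords_cong by blast
qed

lemma hecke_subwords:
  assumes "u \<simeq> v"
  shows "subwords u = subwords v"
  using assms
proof induction
  case (rel u v x y)
  then have "subwords u = subwords v"
  proof (rule hecke_relE)
    fix i assume i: "i \<in> I" "u = [i, i]" "v = [i]"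
    have "subwords [i, i] \<subseteq> subwords [i]"
    proof
      fix w assume "w \<in> subwords [i, i]"
      then obtain u where u: "subseq u [i, i]" "w \<approx> u" unfolding subwords_def by blast
      then consider "subseq u [i]" | "u = [i, i]"
        by (cases u) (auto split: if_splits elim: list_emb.cases)
      then show "w \<in> subwords [i]"
      proof cases
        case 1
        then show ?thesis using u(2) unfolding subwords_def by blast
      next
        case 2
        then have "w \<approx> []" using u(2) cox_square[OF i(1)] by (blast intro: pres_cong.trans)
        then show ?thesis unfolding subwords_def by auto
      qed
    qed
    moreover have "subwords [i] \<subseteq> subwords [i, i]" by (rule subwords_mono) simp
    ultimately show ?thesis using i by blast
  next
    fix i j m assume "i \<in> I" "j \<in> I" "M i j = enat m" "u = alt_word m i j" "v = alt_word m j i"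
    then show ?thesis using subwords_braid[of i j m] subwords_braid[of j i m] M_sym[of i j] by auto
  qed
  then show ?case by (simp add: subwords_append)
qed auto

text \<open>Each word is congruent to a subword of the other one, which by reducedness is at least
  as long. So the lengths agree, and the subword is the whole word.\<close>

lemma reduced_subwords_eq:
  assumes "reduced u" and "reduced v" and "subwords u = subwords v"
  shows "u \<approx> v"
proof -
  have *: "\<exists>b'. subseq b' b \<and> a \<approx> b' \<and> length a \<le> length b'"
    if red: "reduced a" and sub: "subwords a = subwords b" for a b
  proof -
    have "a \<in> subwords b" using self_in_subwords sub by blast
    then obtain b' where "subseq b' b" "a \<approx> b'" unfolding subwords_def by blast
    then show ?thesis using reduced_le[OF red] pres_cong.sym by blast
  qed
  obtain v' where v': "subseq v' v" "u \<approx> v'" "length u \<le> length v'"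
    using *[OF assms(1,3)] by blast
  moreover obtain u' where "subseq u' u" "length v \<le> length u'"
    using *[OF assms(2) assms(3)[symmetric]] by blast
  ultimately have "length v' = length v"
    by (meson antisym list_emb_length order_trans)
  then have "v' = v" using v'(1) subseq_same_length by blast
  then show ?thesis using v'(2) by simp
qed

lemma hecke_eqI:
  assumes "set u \<subseteq> I" and "set v \<subseteq> I" and "subwords u = subwords v"
  shows "u \<simeq> v"
proof -
  obtain u0 v0 where *: "reduced u0" "u0 \<simeq> u" "reduced v0" "v0 \<simeq> v"
    using ex_hecke_reduced assms(1,2) by metis
  then have "u0 \<approx> v0" using reduced_subwords_eq hecke_subwords assms(3) by metis
  then have "u0 \<simeq> v0" using matsumoto * by blast
  then show ?thesis using * by (blast intro: pres_cong.intros)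
qed

lemma reduced_hecke_imp_cox: "reduced u \<Longrightarrow> reduced v \<Longrightarrow> u \<simeq> v \<Longrightarrow> u \<approx> v"
  by (simp add: reduced_subwords_eq hecke_subwords)

text \<open>The subwords of \<open>b @ x\<close> lie between those of \<open>x\<close> and those of
  \<open>a @ b @ x\<close>, and the outer two sets coincide.\<close>

lemma hecke_sandwich:
  assumes "a @ b @ x \<simeq> x" and "set (a @ b @ x) \<subseteq> I"
  shows "b @ x \<simeq> x"
proof (rule hecke_eqI)
  have "subwords (b @ x) \<subseteq> subwords x"
    using subwords_mono[OF subseq_drop_many[OF subseq_order.order_refl, of "b @ x" a]]
      hecke_subwords[OF assms(1)] by simp
  moreover have "subwords x \<subseteq> subwords (b @ x)"
    by (rule subwords_mono) (rule subseq_drop_many[OF subseq_order.order_refl])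
  ultimately show "subwords (b @ x) = subwords x" by blast
qed (use assms(2) in auto)

section \<open>Idempotents and longest elements\<close>

text \<open>The working notion of a longest element: a Hecke word for the longest element of the
  parabolic subgroup on its own support. Absorption on the right follows by reversal.\<close>

definition absorbing :: "'a list \<Rightarrow> bool" where
  "absorbing x \<longleftrightarrow> set x \<subseteq> I \<and> (\<forall>i\<in>set x. i # x \<simeq> x)"

lemma absorbing_set: "absorbing x \<Longrightarrow> set x \<subseteq> I"
  by (simp add: absorbing_def)

text \<open>Cutting \<open>x\<close> before and after an occurrence of \<open>i\<close> and applying
  \<open>hecke_sandwich\<close> twice, both \<open>b @ x\<close> and \<open>i # b @ x\<close> equal
  \<open>x\<close>; comparing them removes \<open>b\<close>.\<close>

lemma idempotent_absorbing:
  assumes "set x \<subseteq> I" and "x @ x \<simeq> x"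
  shows "absorbing x"
  unfolding absorbing_def
proof (intro conjI ballI assms(1))
  fix i assume "i \<in> set x"
  then obtain a b where x: "x = a @ i # b" using split_list by metis
  have "a @ (i # b) @ x \<simeq> x" "(a @ [i]) @ b @ x \<simeq> x"
    using arg_cong[OF x, of "\<lambda>w. w @ x"] assms(2) by simp_all
  moreover have "set (a @ (i # b) @ x) \<subseteq> I" "set ((a @ [i]) @ b @ x) \<subseteq> I"
    using assms(1) x by auto
  ultimately have *: "i # b @ x \<simeq> x" "b @ x \<simeq> x"
    using hecke_sandwich[of a "i # b" x] hecke_sandwich[of "a @ [i]" b x] by simp_all
  show "i # x \<simeq> x"
    using pres_cong.trans[OF pres_cong.sym[OF pres_cong_Cons[OF *(2), of i]] *(1)] .
qed

lemma absorbing_left: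
  assumes "absorbing x" and "set z \<subseteq> set x"
  shows "z @ x \<simeq> x"
  using assms(2)
proof (induction z)
  case (Cons i z)
  then have "i # z @ x \<simeq> i # x" by (intro pres_cong_Cons) simp
  moreover have "i # x \<simeq> x" using assms(1) Cons.prems by (simp add: absorbing_def)
  ultimately show ?case by (auto intro: pres_cong.trans)
qed (simp add: pres_cong.refl)

text \<open>The word \<open>rev x @ x\<close> is Hecke-equal to \<open>x\<close> and is its own
  reversal.\<close>

lemma absorbing_rev:
  assumes "absorbing x"
  shows "rev x \<simeq> x"
proof -
  have x: "rev x @ x \<simeq> x" by (rule absorbing_left[OF assms]) simp
  from hecke_rev[OF this] have "rev x @ x \<simeq> rev x" by simp
  with x show ?thesis by (blast intro: pres_cong.intros)
qed

lemma absorbing_right: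
  assumes "absorbing x" and "set z \<subseteq> set x"
  shows "x @ z \<simeq> x"
proof -
  have "rev z @ x \<simeq> x" by (rule absorbing_left[OF assms(1)]) (use assms(2) in simp)
  from hecke_rev[OF this] have "rev x @ z \<simeq> rev x" by simp
  moreover have "rev x @ z \<simeq> x @ z"
    by (rule pres_cong_right[OF absorbing_rev[OF assms(1)]])
  ultimately show ?thesis using absorbing_rev[OF assms(1)] by (blast intro: pres_cong.intros)
qed

text \<open>The product \<open>x @ y\<close> collapses to either factor.\<close>

lemma absorbing_unique:
  assumes "absorbing x" and "absorbing y" and "set x = set y"
  shows "x \<simeq> y"
  using absorbing_right[OF assms(1), of y] absorbing_left[OF assms(2), of x] assms(3)
  by (blast intro: pres_cong.intros)

section \<open>From words to parabolic subgroups and their longest elements\<close>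

lemma coxeter_elt_eq_iff:
  "set u \<subseteq> I \<Longrightarrow> set v \<subseteq> I \<Longrightarrow> coxeter_elt I M u = coxeter_elt I M v \<longleftrightarrow> u \<approx> v"
  unfolding coxeter_elt_def by (rule pres_class_eq_iff) auto

lemma hecke_elt_eq_iff:
  "set u \<subseteq> I \<Longrightarrow> set v \<subseteq> I \<Longrightarrow> hecke_elt I M u = hecke_elt I M v \<longleftrightarrow> u \<simeq> v"
  unfolding hecke_elt_def by (rule pres_class_eq_iff) auto

lemma coxeter_elt_mult:
  "set u \<subseteq> I \<Longrightarrow> set v \<subseteq> I \<Longrightarrow>
    coxeter_elt I M u \<otimes>\<^bsub>coxeter_group I M\<^esub> coxeter_elt I M v = coxeter_elt I M (u @ v)"
  unfolding coxeter_elt_def coxeter_group_def by (rule mult_pres_class) auto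

lemma coxeter_elt_carrier: "set u \<subseteq> I \<Longrightarrow> coxeter_elt I M u \<in> carrier (coxeter_group I M)"
  by (auto simp: coxeter_elt_def coxeter_group_def carrier_pres_monoid)

lemma coxeter_elt_Nil: "\<one>\<^bsub>coxeter_group I M\<^esub> = coxeter_elt I M []"
  by (simp add: coxeter_elt_def coxeter_group_def one_pres_monoid)

text \<open>The generators are involutions, so closure under inverses adds nothing to the products
  of generators.\<close>

lemma parabolic_eq:
  assumes "K \<subseteq> I"
  shows "parabolic I M K = coxeter_elt I M ` lists K"
proof
  interpret group "coxeter_group I M" using matrix by (rule group_coxeter_group)
  show "parabolic I M K \<subseteq> coxeter_elt I M ` lists K"
  proof
    fix w assume "w \<in> parabolic I M K"
    then show "w \<in> coxeter_elt I M ` lists K"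
      unfolding parabolic_def
    proof (induction rule: generate.induct)
      case one
      then show ?case by (auto simp: coxeter_elt_Nil)
    next
      case (incl h)
      then show ?case by auto
    next
      case (inv h)
      then obtain k where k: "k \<in> K" "h = coxeter_elt I M [k]" by blast
      then have "h \<otimes>\<^bsub>coxeter_group I M\<^esub> h = \<one>\<^bsub>coxeter_group I M\<^esub>"
        using assms cox_square[of k] coxeter_elt_mult[of "[k]" "[k]"]
          coxeter_elt_eq_iff[of "[k, k]" "[]"] by (simp add: coxeter_elt_Nil subset_iff)
      then have "inv\<^bsub>coxeter_group I M\<^esub> h = h"
        using k assms coxeter_elt_carrier[of "[k]"] by (intro inv_equality) auto
      then show ?case using k by auto
    next
      case (eng g h)
      then obtain u v where "u \<in> lists K" "v \<in> lists K"
        "g = coxeter_elt I M u" "h = coxeter_elt I M v" by blast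
      moreover from this have "g \<otimes>\<^bsub>coxeter_group I M\<^esub> h = coxeter_elt I M (u @ v)"
        using assms by (auto intro!: coxeter_elt_mult)
      ultimately show ?case by auto
    qed
  qed
  show "coxeter_elt I M ` lists K \<subseteq> parabolic I M K"
  proof
    fix w assume "w \<in> coxeter_elt I M ` lists K"
    then obtain u where "u \<in> lists K" "w = coxeter_elt I M u" by blast
    moreover from this(1) have "coxeter_elt I M u \<in> parabolic I M K"
    proof induction
      case Nil
      show ?case
        using generate.one[of "coxeter_group I M"] by (simp add: parabolic_def coxeter_elt_Nil)
    next
      case (Cons k u)
      then have "coxeter_elt I M (k # u) =
          coxeter_elt I M [k] \<otimes>\<^bsub>coxeter_group I M\<^esub> coxeter_elt I M u"
        using assms by (subst coxeter_elt_mult) auto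
      moreover have "coxeter_elt I M [k] \<in> parabolic I M K"
        unfolding parabolic_def using Cons by (intro generate.incl) auto
      ultimately show ?case
        using Cons.IH unfolding parabolic_def by (simp add: generate.eng)
    qed
    ultimately show "w \<in> parabolic I M K" by simp
  qed
qed

lemma coxeter_length_reduced:
  assumes "reduced u"
  shows "coxeter_length I M (coxeter_elt I M u) = length u"
  unfolding coxeter_length_def
proof (rule Least_equality)
  show "\<exists>v\<in>lists I. coxeter_elt I M v = coxeter_elt I M u \<and> length v = length u"
    using reduced_set[OF assms] by blast
next
  fix n assume "\<exists>v\<in>lists I. coxeter_elt I M v = coxeter_elt I M u \<and> length v = n"
  then obtain v where "set v \<subseteq> I" "coxeter_elt I M v = coxeter_elt I M u" "length v = n"
    by auto
  then show "length u \<le> n"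
    using reduced_le[OF assms] reduced_set[OF assms] by (auto simp: coxeter_elt_eq_iff)
qed

lemma reduced_word_iff:
  assumes "reduced u"
  shows "reduced_word I M (coxeter_elt I M u) v \<longleftrightarrow> reduced v \<and> v \<approx> u"
proof -
  have "reduced_word I M (coxeter_elt I M u) v \<longleftrightarrow> set v \<subseteq> I \<and> v \<approx> u \<and> length v = length u"
    using reduced_set[OF assms]
    by (simp add: reduced_word_def coxeter_length_reduced[OF assms] coxeter_elt_eq_iff lists_eq_set
        cong: conj_cong)
  also have "\<dots> \<longleftrightarrow> reduced v \<and> v \<approx> u"
    using reduced_cong[OF assms, of v] reduced_length[of v u] reduced_set[of v] assms
      pres_cong.sym[of _ v u] by (metis order_refl)
  finally show ?thesis .
qed

lemma to_hecke_reduced: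
  assumes "reduced u"
  shows "to_hecke I M (coxeter_elt I M u) = hecke_elt I M u"
proof -
  let ?v = "SOME v. reduced_word I M (coxeter_elt I M u) v"
  have "reduced_word I M (coxeter_elt I M u) u"
    using assms by (simp add: reduced_word_iff pres_cong.refl)
  then have "reduced ?v" "?v \<approx> u"
    using someI[of "reduced_word I M (coxeter_elt I M u)"] reduced_word_iff[OF assms] by blast+
  then have "?v \<simeq> u" using matsumoto assms by blast
  then show ?thesis
    unfolding to_hecke_def using reduced_set \<open>reduced ?v\<close> assms by (simp add: hecke_elt_eq_iff)
qed

text \<open>A word \<open>z\<close> over the support is a subword of \<open>z @ x\<close>, which is
  Hecke-equal to \<open>x\<close>. So every element is represented by one of the finitely many
  subsequences of \<open>x\<close>.\<close>

lemma finite_parabolic_absorbing: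
  assumes "absorbing x"
  shows "finite (parabolic I M (set x))"
proof (rule finite_subset)
  have x: "set x \<subseteq> I" using assms by (rule absorbing_set)
  show "parabolic I M (set x) \<subseteq> coxeter_elt I M ` set (subseqs x)"
  proof
    fix w assume "w \<in> parabolic I M (set x)"
    then obtain z where z: "set z \<subseteq> set x" "w = coxeter_elt I M z"
      using parabolic_eq[OF x] by (auto simp: lists_eq_set)
    have "z \<in> subwords (z @ x)"
      using self_in_subwords subwords_mono[OF subseq_rev_drop_many[OF subseq_order.order_refl]] by blast
    then have "z \<in> subwords x"
      using hecke_subwords[OF absorbing_left[OF assms z(1)]] by simp
    then obtain x' where "subseq x' x" "z \<approx> x'" unfolding subwords_def by blast
    moreover from this have "w = coxeter_elt I M x'"
      using z x coxeter_elt_eq_iff[of z x'] cox_set[of z x'] by (simp add: subset_trans)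
    ultimately show "w \<in> coxeter_elt I M ` set (subseqs x)" by auto
  qed
qed simp

text \<open>By maximality every \<open>k\<close> in \<open>K\<close> is a left descent of
  \<open>u\<close>, so \<open>u\<close> is Hecke-equal to a word starting with \<open>k\<close>.
  Hecke relations preserve the support, hence \<open>k\<close> occurs in \<open>u\<close>.\<close>

lemma longest_word_absorbing:
  assumes "K \<subseteq> I" and "reduced u" and "set u \<subseteq> K"
    and "\<And>v. reduced v \<Longrightarrow> set v \<subseteq> K \<Longrightarrow> length v \<le> length u"
  shows "absorbing u" and "set u = K"
proof -
  have *: "k # u \<simeq> u \<and> k \<in> set u" if "k \<in> K" for k
  proof -
    have k: "k \<in> I" using that assms(1) by blast
    have "\<not> reduced (k # u)" using assms(4)[of "k # u"] assms(3) that by auto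
    from descent[OF assms(2) k this] obtain x y where "k # x @ y \<approx> u" "reduced (k # x @ y)"
      by metis
    then have *: "k # x @ y \<simeq> u" using matsumoto assms(2) by blast
    have "k # u \<simeq> u"
      using pres_cong_Cons[OF *, of k] hecke_idem[OF k, of "x @ y"] *
      by (blast intro: pres_cong.intros)
    moreover have "k \<in> set u" using hecke_set[OF *] by auto
    ultimately show ?thesis by blast
  qed
  then show "set u = K" using assms(3) by blast
  then show "absorbing u" using * assms(1) by (simp add: absorbing_def)
qed

lemma ex_absorbing:
  assumes "K \<subseteq> I" and "finite (parabolic I M K)"
  obtains x where "absorbing x" and "set x = K" and "hecke_longest I M K = hecke_elt I M x"
proof -
  let ?W = "parabolic I M K" and ?l = "coxeter_length I M"
  have ex_word: "\<exists>u. reduced u \<and> set u \<subseteq> K \<and> w = coxeter_elt I M u" if w: "w \<in> ?W" for w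
  proof -
    obtain z where z: "set z \<subseteq> K" "w = coxeter_elt I M z"
      using w parabolic_eq[OF assms(1)] by (auto simp: lists_eq_set)
    then obtain u where u: "reduced u" "u \<approx> z" "set u \<subseteq> set z"
      using ex_reduced_subset[of z] assms(1) by blast
    then show ?thesis
      using z assms(1) coxeter_elt_eq_iff[of u z] by (intro exI[of _ u]) auto
  qed
  let ?longest = "\<lambda>w. w \<in> ?W \<and> (\<forall>v\<in>?W. ?l v \<le> ?l w)"
  have word: "absorbing u \<and> set u = K" if "?longest w" "reduced u" "set u \<subseteq> K"
    "w = coxeter_elt I M u" for u w
  proof -
    have "length v \<le> length u" if "reduced v" "set v \<subseteq> K" for v
    proof -
      have "coxeter_elt I M v \<in> ?W" using that(2) parabolic_eq[OF assms(1)] by auto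
      then show ?thesis
        using \<open>?longest w\<close> \<open>w = _\<close> coxeter_length_reduced \<open>reduced u\<close> that(1) by metis
    qed
    then show ?thesis using longest_word_absorbing[OF assms(1) that(2,3)] by blast
  qed
  have "?W \<noteq> {}" using parabolic_eq[OF assms(1)] by auto
  then have "Max (?l ` ?W) \<in> ?l ` ?W" using assms(2) by (intro Max_in) auto
  then obtain w where "w \<in> ?W" "?l w = Max (?l ` ?W)" by auto
  then have w: "?longest w" using assms(2) by simp
  then obtain u where u: "reduced u" "set u \<subseteq> K" "w = coxeter_elt I M u"
    using ex_word by blast
  have abs: "absorbing u \<and> set u = K" using word[OF w u] .
  \<comment> \<open>\<open>longest_elt\<close> is a definite description, so uniqueness has to be
    shown: all longest elements have absorbing reduced words with support \<open>K\<close>.\<close>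
  have "w' = w" if w': "?longest w'" for w'
  proof -
    obtain u' where u': "reduced u'" "set u' \<subseteq> K" "w' = coxeter_elt I M u'"
      using ex_word w' by blast
    have "u' \<simeq> u" using absorbing_unique word[OF w' u'] abs by simp
    then show ?thesis
      using reduced_hecke_imp_cox[OF u'(1) u(1)] u(3) u'(3)
        coxeter_elt_eq_iff[of u' u] reduced_set u(1) u'(1) by simp
  qed
  then have "longest_elt I M K = w"
    unfolding longest_elt_def using w by (intro the_equality) blast+
  then have "hecke_longest I M K = hecke_elt I M u"
    by (simp add: hecke_longest_def u(3) to_hecke_reduced[OF u(1)])
  then show thesis using that abs by blast
qed

lemma hecke_longest_absorbing:
  assumes "absorbing x"
  shows "hecke_longest I M (set x) = hecke_elt I M x"
proof -
  obtain y where "absorbing y" "set y = set x" "hecke_longest I M (set x) = hecke_elt I M y"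
    using ex_absorbing absorbing_set finite_parabolic_absorbing assms by metis
  then show ?thesis
    using absorbing_unique[of y x] assms absorbing_set by (simp add: hecke_elt_eq_iff)
qed

section \<open>Alternating products\<close>

lemma concat_alt_word_set: "set (concat (alt_word m x y)) \<subseteq> set x \<union> set y"
  using set_alt_word[of m x y] by auto

lemma concat_alt_word_set_eq:
  assumes "2 \<le> m"
  shows "set (concat (alt_word m x y)) = set x \<union> set y"
  using set_alt_word_eq[OF assms, of x y] by simp

text \<open>Each block \<open>x @ y\<close> supplies any one letter of \<open>z\<close>, so a long
  alternating product contains \<open>z\<close> as a subword, while \<open>z\<close> absorbs that
  product. This makes the minimum in \<open>hecke_mu\<close> exist.\<close>

lemma concat_alt_word_reaches:
  assumes "absorbing x" and "absorbing y" and "absorbing z" and "set z = set x \<union> set y"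
  obtains m where "0 < m" and "concat (alt_word m x y) \<simeq> z"
proof -
  have sub: "subseq w (concat (alt_word (2 * length w) x y))" if "set w \<subseteq> set x \<union> set y" for w
    using that
  proof (induction w)
    case (Cons i w)
    have "subseq [i] (x @ y)" using Cons.prems by (auto simp: subseq_singleton_left)
    then have "subseq ([i] @ w) ((x @ y) @ concat (alt_word (2 * length w) x y))"
      using Cons by (intro list_emb_append_mono) auto
    then show ?case by simp
  qed simp
  \<comment> \<open>\<open>Suc\<close> keeps the number of factors positive even if \<open>z\<close>
    is empty.\<close>
  have "subseq z (concat (alt_word (2 * Suc (length z)) x y))"
    using sub[of z] assms(4) by (simp add: subseq_drop_many)
  then obtain m where m: "0 < m" "subseq z (concat (alt_word m x y))"
    by (metis zero_less_Suc mult_pos_pos zero_less_numeral)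
  have I: "set z \<subseteq> I" using assms(3) by (rule absorbing_set)
  have set: "set (concat (alt_word m x y)) \<subseteq> set z"
    using concat_alt_word_set[of m x y] assms(4) by simp
  have "concat (alt_word m x y) \<simeq> z"
  proof (rule hecke_eqI)
    have "subwords (concat (alt_word m x y)) \<subseteq> subwords (concat (alt_word m x y) @ z)"
      by (rule subwords_mono) (rule subseq_rev_drop_many[OF subseq_order.order_refl])
    also have "\<dots> = subwords z" by (rule hecke_subwords[OF absorbing_left[OF assms(3) set]])
    finally show "subwords (concat (alt_word m x y)) = subwords z"
      using subwords_mono[OF m(2)] by blast
  qed (use I set in auto)
  then show thesis using that m(1) by blast
qed

lemma concat_alt_word_stable:
  assumes "absorbing z" and "set x \<union> set y \<subseteq> set z" and "m \<le> n"
    and "concat (alt_word m x y) \<simeq> z"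
  shows "concat (alt_word n x y) \<simeq> z"
proof -
  obtain w where w: "concat (alt_word n x y) = concat (alt_word m x y) @ concat w"
      "set w \<subseteq> {x, y}"
    using alt_word_add[of m "n - m" x y] assms(3) set_alt_word[of "n - m" x y]
      set_alt_word[of "n - m" y x] by (cases "even m") auto
  have "set (concat w) \<subseteq> set z" using w(2) assms(2) by auto
  then show ?thesis
    unfolding w(1) using pres_cong_right[OF assms(4)] absorbing_right[OF assms(1)]
    by (blast intro: pres_cong.trans)
qed

text \<open>A product starting with an absorbing factor absorbs the letters of that factor, and the
  common value starts with \<open>x\<close> as well as with \<open>y\<close>. With two or more
  factors no further letters occur.\<close>

lemma absorbing_concat_alt_word:
  assumes "absorbing x" and "absorbing y" and "2 \<le> m"
    and "concat (alt_word m x y) \<simeq> concat (alt_word m y x)"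
  shows "absorbing (concat (alt_word m x y))"
proof -
  obtain m' where m: "m = Suc m'" using assms(3) by (cases m) auto
  have *: "i # concat (alt_word m a b) \<simeq> concat (alt_word m a b)"
    if "absorbing a" "i \<in> set a" for i a b
    using pres_cong_right[of _ "i # a" a "concat (alt_word m' b a)"] that
    by (simp add: m absorbing_def)
  have "i # concat (alt_word m x y) \<simeq> concat (alt_word m x y)" if "i \<in> set y" for i
    using *[OF assms(2) that, of x] pres_cong_Cons[OF assms(4), of i] assms(4)
    by (blast intro: pres_cong.trans pres_cong.sym)
  then show ?thesis
    using *[OF assms(1), of _ y] absorbing_set assms(1,2)
    unfolding absorbing_def[of "concat _"] concat_alt_word_set_eq[OF assms(3)] by blast
qed

lemma hecke_elt_mult:
  "set u \<subseteq> I \<Longrightarrow> set v \<subseteq> I \<Longrightarrow>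
    hecke_elt I M u \<otimes>\<^bsub>hecke_monoid I M\<^esub> hecke_elt I M v = hecke_elt I M (u @ v)"
  unfolding hecke_elt_def hecke_monoid_def by (rule mult_pres_class) auto

lemma hecke_elt_Nil: "\<one>\<^bsub>hecke_monoid I M\<^esub> = hecke_elt I M []"
  by (simp add: hecke_elt_def hecke_monoid_def one_pres_monoid)

lemma carrier_hecke_monoid: "carrier (hecke_monoid I M) = hecke_elt I M ` lists I"
  unfolding hecke_monoid_def hecke_elt_def[abs_def] by (rule carrier_pres_monoid)

lemma alt_prod_hecke:
  assumes "set x \<subseteq> I" and "set y \<subseteq> I"
  shows "alt_prod (hecke_monoid I M) m (hecke_elt I M x) (hecke_elt I M y) =
    hecke_elt I M (concat (alt_word m x y))"
  using assms
proof (induction m arbitrary: x y)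
  case (Suc m)
  have "set (concat (alt_word m y x)) \<subseteq> I"
    using concat_alt_word_set[of m y x] Suc.prems by blast
  then show ?case using Suc by (simp add: hecke_elt_mult)
qed (simp add: hecke_elt_Nil)

text \<open>Once reached, \<open>z\<close> is kept by \<open>concat_alt_word_stable\<close>, so
  comparing the minimum with \<open>m\<close> amounts to a test at \<open>m\<close> itself.\<close>

lemma hecke_mu_le_iff:
  assumes "absorbing x" and "absorbing y" and "absorbing z" and "set z = set x \<union> set y"
    and "0 < m"
  shows "hecke_mu I M (set x) (set y) \<le> m \<longleftrightarrow> concat (alt_word m x y) \<simeq> z"
proof -
  let ?P = "\<lambda>m. 0 < m \<and> concat (alt_word m x y) \<simeq> z"
  have "set (concat (alt_word m x y)) \<subseteq> I" for m
    using concat_alt_word_set[of m x y] absorbing_set assms(1,2) by blast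
  moreover have "hecke_longest I M (set x \<union> set y) = hecke_elt I M z"
    using hecke_longest_absorbing[OF assms(3)] assms(4) by simp
  ultimately have mu: "hecke_mu I M (set x) (set y) = (LEAST m. ?P m)"
    using assms(1-3)
    by (simp add: hecke_mu_def hecke_longest_absorbing alt_prod_hecke absorbing_set hecke_elt_eq_iff
        del: set_concat)
  obtain m0 where "?P m0" using concat_alt_word_reaches[OF assms(1-4)] by blast
  then have "?P (hecke_mu I M (set x) (set y))" unfolding mu by (rule LeastI)
  moreover have "hecke_mu I M (set x) (set y) \<le> m" if "?P m"
    unfolding mu using that by (rule Least_le)
  ultimately show ?thesis
    using concat_alt_word_stable[OF assms(3), of x y] assms(4,5) by blast
qed

lemma braid_iff:
  assumes "absorbing x" and "absorbing y" and "2 \<le> m"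
  shows "concat (alt_word m x y) \<simeq> concat (alt_word m y x) \<longleftrightarrow>
    finite (parabolic I M (set x \<union> set y)) \<and>
    max (hecke_mu I M (set x) (set y)) (hecke_mu I M (set y) (set x)) \<le> m"
    (is "?L \<longleftrightarrow> ?R")
proof
  let ?z = "concat (alt_word m x y)"
  assume L: ?L
  have z: "absorbing ?z" using assms L by (rule absorbing_concat_alt_word)
  have set: "set ?z = set x \<union> set y" using assms(3) by (rule concat_alt_word_set_eq)
  have "hecke_mu I M (set x) (set y) \<le> m"
    using hecke_mu_le_iff[OF assms(1,2) z set] assms(3) pres_cong.refl by simp
  moreover have "hecke_mu I M (set y) (set x) \<le> m"
    using hecke_mu_le_iff[OF assms(2,1) z] set assms(3) pres_cong.sym[OF L] by (simp add: Un_commute)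
  ultimately show ?R using finite_parabolic_absorbing[OF z] unfolding set by simp
next
  assume R: ?R
  have "set x \<union> set y \<subseteq> I" using absorbing_set assms(1,2) by blast
  then obtain z where z: "absorbing z" "set z = set x \<union> set y"
    using ex_absorbing R by metis
  have "concat (alt_word m x y) \<simeq> z"
    using hecke_mu_le_iff[OF assms(1,2) z, of m] R assms(3) by simp
  moreover have "concat (alt_word m y x) \<simeq> z"
    using hecke_mu_le_iff[OF assms(2,1) z(1), of m] z(2) R assms(3) by (simp add: Un_commute)
  ultimately show ?L by (blast intro: pres_cong.intros)
qed

end

section \<open>Homomorphisms of presented monoids and the theorem\<close>

lemma ex_hom_pres_monoid:
  assumes f: "\<And>i. i \<in> S \<Longrightarrow> f i \<in> lists S'"
    and rel: "\<And>u v. (u, v) \<in> R \<Longrightarrow> pres_cong R' (concat (map f u)) (concat (map f v))"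
  shows "\<exists>\<phi>\<in>monoid_hom (pres_monoid S R) (pres_monoid S' R').
    \<forall>i\<in>S. \<phi> (pres_class S R [i]) = pres_class S' R' (f i)"
proof -
  \<comment> \<open>The image is read off from a chosen representative; compatibility with the
    relations makes it independent of the choice.\<close>
  define \<phi> where "\<phi> A = pres_class S' R' (concat (map f (SOME u. u \<in> lists S \<and> pres_class S R u = A)))"
    for A
  have lists: "concat (map f u) \<in> lists S'" if "u \<in> lists S" for u
    using that
  proof induction
    case (Cons i u)
    then show ?case using f[OF Cons.hyps(1)] by simp
  qed simp
  have \<phi>: "\<phi> (pres_class S R u) = pres_class S' R' (concat (map f u))" if u: "u \<in> lists S" for u
  proof -
    define v where "v = (SOME v. v \<in> lists S \<and> pres_class S R v = pres_class S R u)"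
    have v: "v \<in> lists S \<and> pres_class S R v = pres_class S R u"
      unfolding v_def by (rule someI[of _ u]) (use u in blast)
    then have "pres_cong R v u" using pres_class_eq_iff[of v S u R] u by blast
    then have "pres_cong R' (concat (map f v)) (concat (map f u))"
      by (rule pres_cong_map) (simp_all add: rel)
    then show ?thesis
      unfolding \<phi>_def v_def[symmetric] by (simp only: pres_class_eq_iff lists v u)
  qed
  have "\<phi> \<in> hom (pres_monoid S R) (pres_monoid S' R')"
  proof (rule homI)
    fix A assume "A \<in> carrier (pres_monoid S R)"
    then show "\<phi> A \<in> carrier (pres_monoid S' R')"
      unfolding carrier_pres_monoid using \<phi> lists by blast
  next
    fix A B assume "A \<in> carrier (pres_monoid S R)" "B \<in> carrier (pres_monoid S R)"
    then obtain u v where uv: "u \<in> lists S" "A = pres_class S R u" "v \<in> lists S" "B = pres_class S R v"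
      unfolding carrier_pres_monoid by blast
    then have "u @ v \<in> lists S" by simp
    then show "\<phi> (A \<otimes>\<^bsub>pres_monoid S R\<^esub> B) = \<phi> A \<otimes>\<^bsub>pres_monoid S' R'\<^esub> \<phi> B"
      using uv lists by (simp only: mult_pres_class \<phi> map_append concat_append)
  qed
  moreover have "\<phi> \<one>\<^bsub>pres_monoid S R\<^esub> = \<one>\<^bsub>pres_monoid S' R'\<^esub>"
    using \<phi>[of "[]"] by (simp add: one_pres_monoid)
  moreover have "\<phi> (pres_class S R [i]) = pres_class S' R' (f i)" if "i \<in> S" for i
    using \<phi>[of "[i]"] that by simp
  ultimately show ?thesis unfolding monoid_hom_def by blast
qed

lemma hom_alt_prod:
  assumes "\<phi> \<in> monoid_hom G H" and "monoid G" and "x \<in> carrier G" and "y \<in> carrier G"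
  shows "\<phi> (alt_prod G m x y) = alt_prod H m (\<phi> x) (\<phi> y)"
proof -
  interpret monoid G by fact
  have "alt_prod G m x y \<in> carrier G \<and> \<phi> (alt_prod G m x y) = alt_prod H m (\<phi> x) (\<phi> y)"
    using assms(3,4)
  proof (induction m arbitrary: x y)
    case 0
    then show ?case using assms(1) by (simp add: monoid_hom_def)
  next
    case (Suc m)
    have "alt_prod G m y x \<in> carrier G" "\<phi> (alt_prod G m y x) = alt_prod H m (\<phi> y) (\<phi> x)"
      using Suc.IH[OF Suc.prems(2,1)] by blast+
    then show ?case using assms(1) Suc.prems(1) hom_mult[of \<phi> G H] by (simp add: monoid_hom_def)
  qed
  then show ?thesis by blast
qed

theorem theorem1p3:
  fixes I :: "'a set" and M :: "'a \<Rightarrow> 'a \<Rightarrow> enat"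
    and I' :: "'b set" and M' :: "'b \<Rightarrow> 'b \<Rightarrow> enat"
  assumes "coxeter_matrix I M" and "coxeter_matrix I' M'"
  shows "(\<forall>K. admissible_family I' I M K \<longrightarrow>
           ((\<exists>\<phi>. is_phi I' M' I M K \<phi>) \<longleftrightarrow>
            (\<forall>i\<in>I'. \<forall>j\<in>I'. i \<noteq> j \<longrightarrow>
               M' i j = \<infinity> \<or>
               (finite (parabolic I M (K i \<union> K j)) \<and>
                enat (max (hecke_mu I M (K i) (K j)) (hecke_mu I M (K j) (K i))) \<le> M' i j)))) \<and>
         (\<forall>\<phi> \<in> monoid_hom (hecke_monoid I' M') (hecke_monoid I M).
            \<exists>K. admissible_family I' I M K \<and> is_phi I' M' I M K \<phi>)"
proof (intro conjI allI impI ballI)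
  interpret W: coxeter I M by unfold_locales fact
  interpret W': coxeter I' M' by unfold_locales fact
  have monoid_hecke: "monoid (hecke_monoid I' M')"
    unfolding hecke_monoid_def by (rule monoid_pres_monoid)
  fix K assume K: "admissible_family I' I M K"
  have "\<forall>i\<in>I'. \<exists>x. W.absorbing x \<and> set x = K i \<and> hecke_longest I M (K i) = hecke_elt I M x"
    using K W.ex_absorbing unfolding admissible_family_def by metis
  then obtain x where x: "\<And>i. i \<in> I' \<Longrightarrow> W.absorbing (x i)" "\<And>i. i \<in> I' \<Longrightarrow> set (x i) = K i"
      "\<And>i. i \<in> I' \<Longrightarrow> hecke_longest I M (K i) = hecke_elt I M (x i)"
    by metis
  let ?braid = "\<lambda>i j m. pres_cong (hecke_rels I M) (concat (alt_word m (x i) (x j)))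
    (concat (alt_word m (x j) (x i)))"
  \<comment> \<open>Off-diagonal entries of \<open>M'\<close> are at least 2, as
    \<open>braid_iff\<close> demands.\<close>
  have braid: "(finite (parabolic I M (K i \<union> K j)) \<and>
      enat (max (hecke_mu I M (K i) (K j)) (hecke_mu I M (K j) (K i))) \<le> M' i j) \<longleftrightarrow> ?braid i j m"
    if "i \<in> I'" "j \<in> I'" "i \<noteq> j" "M' i j = enat m" for i j m
    using W.braid_iff[of "x i" "x j" m] x that W'.M_ge_2[OF that(1-3)]
    by (simp add: numeral_eq_enat)
  have xI: "set (x i) \<subseteq> I" if "i \<in> I'" for i using x(1)[OF that] by (rule W.absorbing_set)
  show "(\<exists>\<phi>. is_phi I' M' I M K \<phi>) \<longleftrightarrow>
      (\<forall>i\<in>I'. \<forall>j\<in>I'. i \<noteq> j \<longrightarrow> M' i j = \<infinity> \<or> (finite (parabolic I M (K i \<union> K j)) \<and>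
        enat (max (hecke_mu I M (K i) (K j)) (hecke_mu I M (K j) (K i))) \<le> M' i j))"
    (is "?L \<longleftrightarrow> ?R")
  proof
    assume ?L
    then obtain \<phi> where \<phi>: "\<phi> \<in> monoid_hom (hecke_monoid I' M') (hecke_monoid I M)"
        "\<And>i. i \<in> I' \<Longrightarrow> \<phi> (hecke_elt I' M' [i]) = hecke_elt I M (x i)"
      using x(3) by (auto simp: is_phi_def hecke_gen_def)
    have "?braid i j m" if ij: "i \<in> I'" "j \<in> I'" "i \<noteq> j" "M' i j = enat m" for i j m
    proof -
      have img: "\<phi> (hecke_elt I' M' (alt_word m i j)) = hecke_elt I M (concat (alt_word m (x i) (x j)))"
        if "i \<in> I'" "j \<in> I'" for i j
      proof -
        \<comment> \<open>Reading each letter as a one-letter factor makes the word an alternating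
          product, which \<open>\<phi>\<close> carries to an alternating product.\<close>
        have "concat (alt_word m [i] [j]) = alt_word m i j"
          using map_alt_word[of "\<lambda>k. [k]" m i j] concat_map_singleton[of "\<lambda>k. k" "alt_word m i j"]
          by simp
        then have "hecke_elt I' M' (alt_word m i j) =
            alt_prod (hecke_monoid I' M') m (hecke_elt I' M' [i]) (hecke_elt I' M' [j])"
          using W'.alt_prod_hecke[of "[i]" "[j]" m] that by simp
        also have "\<phi> \<dots> = alt_prod (hecke_monoid I M) m (hecke_elt I M (x i)) (hecke_elt I M (x j))"
          using \<phi> that
          by (subst hom_alt_prod[of \<phi> _ "hecke_monoid I M"])
            (auto simp: W'.carrier_hecke_monoid monoid_hecke)
        finally show ?thesis using W.alt_prod_hecke xI that by simp
      qed
      have "hecke_elt I' M' (alt_word m i j) = hecke_elt I' M' (alt_word m j i)"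
        using W'.hecke_braid[OF ij] set_alt_word[of m i j] set_alt_word[of m j i] ij
        by (subst W'.hecke_elt_eq_iff) auto
      then have "hecke_elt I M (concat (alt_word m (x i) (x j))) =
          hecke_elt I M (concat (alt_word m (x j) (x i)))"
        using img ij by metis
      moreover have "set (concat (alt_word m (x k) (x l))) \<subseteq> I" if "k \<in> I'" "l \<in> I'" for k l
        using W.concat_alt_word_set[of m "x k" "x l"] xI that by blast
      ultimately show ?thesis using W.hecke_elt_eq_iff ij by blast
    qed
    then show ?R using braid by (metis enat.exhaust)
  next
    assume R: ?R
    have "pres_cong (hecke_rels I M) (concat (map x u)) (concat (map x v))"
      if uv: "(u, v) \<in> hecke_rels I' M'" for u v
      using uv
    proof (rule W'.hecke_relE)
      fix i assume "i \<in> I'" "u = [i, i]" "v = [i]"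
      then show ?thesis using W.absorbing_left[OF x(1), of i "x i"] by simp
    next
      fix i j m
      assume *: "i \<in> I'" "j \<in> I'" "i \<noteq> j" "M' i j = enat m" "u = alt_word m i j" "v = alt_word m j i"
      then have "?braid i j m" using braid[of i j m] R by fastforce
      then show ?thesis using * by (simp add: map_alt_word)
    qed
    moreover have "x i \<in> lists I" if "i \<in> I'" for i using xI[OF that] by auto
    ultimately obtain \<phi> where "\<phi> \<in> monoid_hom (hecke_monoid I' M') (hecke_monoid I M)"
        "\<And>i. i \<in> I' \<Longrightarrow> \<phi> (hecke_elt I' M' [i]) = hecke_elt I M (x i)"
      using ex_hom_pres_monoid[of I' x I "hecke_rels I' M'" "hecke_rels I M"]
      unfolding hecke_monoid_def hecke_elt_def by blast
    then show ?L using x(3) by (auto simp: is_phi_def hecke_gen_def)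
  qed
next
  interpret W: coxeter I M by unfold_locales fact
  interpret W': coxeter I' M' by unfold_locales fact
  fix \<phi> assume \<phi>: "\<phi> \<in> monoid_hom (hecke_monoid I' M') (hecke_monoid I M)"
  \<comment> \<open>A generator is idempotent, hence so is its image. The set \<open>K i\<close>
    will be the support of a word for this image.\<close>
  have "\<exists>x. W.absorbing x \<and> \<phi> (hecke_gen I' M' i) = hecke_elt I M x" if i: "i \<in> I'" for i
  proof -
    let ?s = "hecke_gen I' M' i"
    have s: "?s \<in> carrier (hecke_monoid I' M')"
      using i by (auto simp: hecke_gen_def W'.carrier_hecke_monoid)
    then have "\<phi> ?s \<in> carrier (hecke_monoid I M)"
      using \<phi> by (auto simp: monoid_hom_def hom_def)
    then obtain x where x: "set x \<subseteq> I" "\<phi> ?s = hecke_elt I M x"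
      by (auto simp: W.carrier_hecke_monoid lists_eq_set)
    have "?s \<otimes>\<^bsub>hecke_monoid I' M'\<^esub> ?s = ?s"
      using W'.hecke_idem[OF i, of "[]"] i W'.hecke_elt_mult[of "[i]" "[i]"]
        W'.hecke_elt_eq_iff[of "[i, i]" "[i]"] by (simp add: hecke_gen_def)
    then have "\<phi> ?s \<otimes>\<^bsub>hecke_monoid I M\<^esub> \<phi> ?s = \<phi> ?s"
      using \<phi> s hom_mult[of \<phi> "hecke_monoid I' M'" "hecke_monoid I M" ?s ?s]
      by (simp add: monoid_hom_def)
    then have "W.absorbing x"
      using x W.hecke_elt_mult[of x x] W.hecke_elt_eq_iff[of "x @ x" x]
      by (intro W.idempotent_absorbing) simp_all
    then show ?thesis using x(2) by blast
  qed
  then obtain x where x: "\<And>i. i \<in> I' \<Longrightarrow> W.absorbing (x i)"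
      "\<And>i. i \<in> I' \<Longrightarrow> \<phi> (hecke_gen I' M' i) = hecke_elt I M (x i)"
    by metis
  then have "admissible_family I' I M (\<lambda>i. set (x i))"
    unfolding admissible_family_def
    using W.absorbing_set W.finite_parabolic_absorbing by blast
  moreover have "is_phi I' M' I M (\<lambda>i. set (x i)) \<phi>"
    unfolding is_phi_def using \<phi> x W.hecke_longest_absorbing by simp
  ultimately show "\<exists>K. admissible_family I' I M K \<and> is_phi I' M' I M K \<phi>" by blast
qed

end
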